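(* Let $N\ge3$ be an integer, $0<c<1$, $x_1^*,x_2^*>0$, and put $\rho=\sqrt{x_2^*/x_1^*}$, $\beta=1-c^2$, $\lambda=\frac{x_1^*}{2\beta}$. Suppose that $\lambda>1$, that $$x_1^*x_2^*>\frac{(1-c^2)^2}{c^2}\left(\left(\tfrac N4-1\right)^2 I(N>4)+\left(\tfrac N4\right)^2 I(N=3)\right)$$ (where $I(A)=1$ if condition $A$ holds and $I(A)=0$ otherwise), and that $c<\rho<\frac1c$. Then the set of numbers $\varepsilon$ satisfying $$0<\varepsilon<\min\left(\frac\rho c-1,\ \frac1c-\rho\right),\qquad \varepsilon\bigl(2\min(\rho-c,1-c\rho)+\varepsilon\bigr)<\frac{1-c^2}{c^2}-(\rho^2-2c\rho+1)$$ is nonempty, and for each such $\varepsilon$ there are real numbers $\theta_1,\dots,\theta_7,\tilde I_4,I_6$ such that $$\alpha(x_1^*,x_2^* )=\frac{(x_1^*x_2^* )^{\frac N4}}{(2c)^{\frac N2-1}\Gamma(\frac{N-1}2)\sqrt{\pi(1-c^2)}}\cdot I_2\cdot(1+\theta_1),$$ where, with $\delta=\frac{N-3}2$, $$I_2=\int_1^\infty dt_1\int_1^\infty dt_2\, e^{-\lambda(t_1^2-2c\rho t_1t_2+\rho^2t_2^2)}(t_1t_2)^{\delta+\frac12}$$ $$=e^{-\lambda(\rho^2-2c\rho+1)}\left(\frac{(1+\theta_2)(1-\theta_3)(1-\theta_4)(1+\theta_5)(1-\theta_6)(1-\theta_7)}{4\lambda^2\rho(\rho-c)(1-c\rho)}+\tilde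 I_4\right),$$ and $$0\le\tilde I_4\le e^{-\lambda\varepsilon(2\min(\rho-c,1-c\rho)+\varepsilon)}\cdot e^{\rho^2-2c\rho+1+\varepsilon(2\min(\rho-c,1-c\rho)+\varepsilon)}\, I_6,$$ $$0\le I_6\le\frac1{\rho^{\frac N2}}\left((2c)^{\frac N2-1}\sqrt\pi\,\frac{\Gamma(\frac{N-1}2)}{2(1-c^2)^{\frac{N-1}2}}+2^{\frac N2-2}\,\frac{\left(\Gamma(\frac N4)\right)^2}{2(1-c^2)^{\frac N4}}\right),$$ $$|\theta_1|\le\Psi\left(\frac{N-3}2,\frac{c\sqrt{x_1^*x_2^*}}{1-c^2}\right),\qquad 0\le\theta_2\le\left((1+\varepsilon)\left(1+\frac\varepsilon\rho\right)\right)^{\frac N2-1}-1,\qquad 0\le\theta_3\le\frac{\varepsilon}{\rho-c},$$ $$0\le\theta_4\le e^{-\lambda\varepsilon(2(\rho-c-c\varepsilon)+\varepsilon)},\qquad 0\le\theta_5\le\frac{c\varepsilon}{\rho-c-c\varepsilon},$$ $$0\le\theta_6\le\frac{\varepsilon}{1-c\rho+\varepsilon},\qquad \theta_7=e^{-\lambda\varepsilon(2(1-c\rho)+\varepsilon)}.$$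
   Context: Definition of $\alpha$. Consider independent trials with $N$ outcomes, the $j$-th outcome having probability $p_j>0$ ($\sum_j p_j=1$). Let $\nu_j(n)$ be the number of occurrences of outcome $j$ in the first $n$ trials and $X(n)=\sum_{j=1}^N\frac{(\nu_j(n)-np_j)^2}{np_j}$ the Pearson statistic. For $c\in(0,1)$, $\alpha(x_1^*,x_2^* )$ denotes the limit of $P(X(n_1)>x_1^*,X(n_2)>x_2^* )$ as $n_1<n_2$ tend to infinity with $\sqrt{n_1/n_2}\to c$. The paper takes as its starting point the known formula $$\alpha(x_1^*,x_2^* )=\int_{x_1^*/2}^\infty\int_{x_2^*/2}^\infty p_{2,0}(u_1,u_2)\,du_2\,du_1,$$ $$p_{2,0}(u_1,u_2)=\frac{e^{-(\frac{u_1}\beta+\frac{u_2}\beta)}}{K_2^{1+\delta}c^\delta\Gamma(1+\delta)\beta^2}\left(\frac{u_1u_2}{\beta^2}\right)^{\frac\delta2}I_\delta\left(\frac{2c\sqrt{u_1u_2}}\beta\right),$$ where $\beta=1-c^2$, $K_2=\frac1{1-c^2}$, $\delta=\frac{N-3}2$, and $I_\delta(x)=\sum_{k=0}^\infty\frac{(x/2)^{\delta+2k}}{\Gamma(k+1)\Gamma(k+\delta+1)}$ is the Infeld (modified Bessel) function. Definition of $\Psi$: $$\Psi(\nu,x):=e^{-2x}+\left(\frac{|4\nu^2-1|}{8x}+G(\nu,x)\cdot\frac{|(4\nu^2-1)(4\nu^2-9)|}{32x^2}\right)(1+e^{-2x}),$$ where $G(\nu,x)=\left(1-\frac{\nu-\frac12}{2x}\right)^{-2\nu-1}$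 if $\nu\ge\frac12$, and $G(\nu,x)=\left(1-\frac{\nu+\frac32}{2x}\right)^{-\nu-\frac32}\left(1+\frac{2\nu+2}{x}\right)$ if $0\le\nu<\frac12$; for $\nu=\frac12$, $\Psi(\frac12,x)=e^{-2x}$. *)

theory Defs
  imports "HOL-Probability.Probability"
begin

text \<open>Trials are numbered from 0 and outcomes from 1: \<open>T i \<omega>\<close> is the outcome of trial \<open>i\<close>, so the
  first \<open>n\<close> trials are those with \<open>i < n\<close>.\<close>

definition occurrences :: "(nat \<Rightarrow> 'a \<Rightarrow> nat) \<Rightarrow> nat \<Rightarrow> nat \<Rightarrow> 'a \<Rightarrow> nat" where
  "occurrences T j n \<omega> = card {i. i < n \<and> T i \<omega> = j}"

definition pearson ::
    "nat \<Rightarrow> (nat \<Rightarrow> real) \<Rightarrow> (nat \<Rightarrow> 'a \<Rightarrow> nat) \<Rightarrow> nat \<Rightarrow> 'a \<Rightarrow> real" where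
  "pearson N p T n \<omega> =
     (\<Sum>j=1..N. (real (occurrences T j n \<omega>) - real n * p j)\<^sup>2 / (real n * p j))"

definition trials :: "'a measure \<Rightarrow> nat \<Rightarrow> (nat \<Rightarrow> real) \<Rightarrow> (nat \<Rightarrow> 'a \<Rightarrow> nat) \<Rightarrow> bool" where
  "trials M N p T \<longleftrightarrow>
     prob_space M \<and>
     prob_space.indep_vars M (\<lambda>_. count_space {1..N}) T UNIV \<and>
     (\<forall>j\<in>{1..N}. p j > 0) \<and> (\<Sum>j=1..N. p j) = 1 \<and>
     (\<forall>i. \<forall>j\<in>{1..N}. measure M {\<omega> \<in> space M. T i \<omega> = j} = p j)"

definition exceedance ::
    "'a measure \<Rightarrow> nat \<Rightarrow> (nat \<Rightarrow> real) \<Rightarrow> (nat \<Rightarrow> 'a \<Rightarrow> nat) \<Rightarrow> real \<Rightarrow> real \<Rightarrow> nat \<times> nat \<Rightarrow> real" where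
  "exceedance M N p T x1 x2 = (\<lambda>(n1, n2).
     measure M {\<omega> \<in> space M. pearson N p T n1 \<omega> > x1 \<and> pearson N p T n2 \<omega> > x2})"

text \<open>The regime \<open>n1 < n2\<close>, both tending to infinity, with \<open>sqrt (n1 / n2)\<close> tending to \<open>c\<close>.\<close>

definition regime :: "real \<Rightarrow> (nat \<times> nat) filter" where
  "regime c =
     inf (inf (at_top \<times>\<^sub>F at_top) (principal {(n1, n2). n1 < n2}))
         (filtercomap (\<lambda>(n1, n2). sqrt (real n1 / real n2)) (nhds c))"

definition alpha ::
    "'a measure \<Rightarrow> nat \<Rightarrow> (nat \<Rightarrow> real) \<Rightarrow> (nat \<Rightarrow> 'a \<Rightarrow> nat) \<Rightarrow> real \<Rightarrow> real \<Rightarrow> real \<Rightarrow> real" where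
  "alpha M N p T c x1 x2 = Lim (regime c) (exceedance M N p T x1 x2)"

text \<open>The Infeld function is used for \<open>x > 0\<close> only (at \<open>x = 0\<close>, \<open>\<nu> = 0\<close> the convention
  \<open>0 powr 0 = 0\<close> would give the wrong value).\<close>

definition bessel_I :: "real \<Rightarrow> real \<Rightarrow> real" where
  "bessel_I \<nu> x =
     (\<Sum>k. (x / 2) powr (\<nu> + 2 * real k) / (Gamma (real k + 1) * Gamma (real k + \<nu> + 1)))"

definition p20 :: "nat \<Rightarrow> real \<Rightarrow> real \<Rightarrow> real \<Rightarrow> real" where
  "p20 N c u1 u2 =
     (let \<beta> = 1 - c\<^sup>2; K2 = 1 / (1 - c\<^sup>2); \<delta> = (real N - 3) / 2 in
      exp (- (u1 / \<beta> + u2 / \<beta>))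
        / (K2 powr (1 + \<delta>) * c powr \<delta> * Gamma (1 + \<delta>) * \<beta>\<^sup>2)
      * (u1 * u2 / \<beta>\<^sup>2) powr (\<delta> / 2)
      * bessel_I \<delta> (2 * c * sqrt (u1 * u2) / \<beta>))"

definition G_fun :: "real \<Rightarrow> real \<Rightarrow> real" where
  "G_fun \<nu> x =
     (if \<nu> \<ge> 1/2 then (1 - (\<nu> - 1/2) / (2 * x)) powr (- 2 * \<nu> - 1)
      else (1 - (\<nu> + 3/2) / (2 * x)) powr (- \<nu> - 3/2) * (1 + (2 * \<nu> + 2) / x))"

text \<open>For \<open>\<nu> = 1/2\<close> the factor \<open>4 * \<nu>\<^sup>2 - 1\<close> vanishes and \<open>Psi (1/2) x = exp (- 2 * x)\<close>.\<close>

definition Psi :: "real \<Rightarrow> real \<Rightarrow> real" where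
  "Psi \<nu> x =
     exp (- 2 * x) +
     (\<bar>4 * \<nu>\<^sup>2 - 1\<bar> / (8 * x)
       + G_fun \<nu> x * (\<bar>(4 * \<nu>\<^sup>2 - 1) * (4 * \<nu>\<^sup>2 - 9)\<bar> / (32 * x\<^sup>2))) * (1 + exp (- 2 * x))"

end

theory Submission
  imports Defs
begin

text \<open>
  The limit probability is the integral of \<open>p20\<close> over a quadrant. Substituting
  \<open>u1 = x1 * x\<^sup>2 / 2\<close> and \<open>u2 = x1 * y\<^sup>2 / 2\<close> moves the corner of the quadrant to \<open>(1, \<rho>)\<close> and turns
  the argument of the Infeld function into \<open>z = 2 * c * lam * x * y\<close>. For large \<open>z\<close> the Infeld
  function behaves like \<open>exp z / sqrt (2 * pi * z)\<close>. Replacing it by this leading term leaves, up to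
  a constant, the weight
  \<open>exp (- lam * (x\<^sup>2 - 2 * c * x * y + y\<^sup>2)) * (x * y) powr (N / 2 - 1)\<close>; its integral over the
  quadrant is \<open>I2\<close> up to the factor \<open>\<rho> powr (N / 2)\<close> that comes from \<open>y = \<rho> * t2\<close>. If the relative
  error of the replacement is at most \<open>\<Psi>\<close> at every point of the quadrant, then so is the relative
  error of the integrals. This is \<open>\<theta>1\<close> (\<open>tail_integral_relative_error\<close>).

  The pointwise error bound (\<open>scaled_bessel_within_Psi\<close>) rests on the Poisson integral. With
  \<open>a = \<nu> + 1/2\<close> it says that \<open>exp (- x) * sqrt (2 * pi * x) * I\<^sub>\<nu> x\<close> is the mean of
  \<open>(1 - Y) powr (a - 1)\<close>, cut off at \<open>Y = 1\<close>, where \<open>2 * x * Y\<close> has the Gamma distribution of shape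
  \<open>a\<close>. A cubic polynomial in \<open>Y\<close> above or below this function has an explicit mean, which is a
  polynomial in \<open>1 / x\<close>. For \<open>\<nu> \<ge> 3/2\<close> Bernoulli's inequality is enough, for \<open>\<nu> = 1/2\<close> the mean is
  elementary, and for \<open>\<nu> = 1\<close> a quadratic bound on the square root gives the two terms of \<open>\<Psi>\<close> in
  \<open>1 / x\<close> and \<open>1 / x\<^sup>2\<close> with \<open>G\<close> replaced by \<open>1\<close>. For \<open>\<nu> = 0\<close> the function of \<open>Y\<close> is singular at \<open>1\<close>; the recurrence
  \<open>I\<^sub>0 x = I\<^sub>2 x + (2 / x) * I\<^sub>1 x\<close> expresses the value by two cases in which it is not.

  The expansion of \<open>I2\<close> (\<open>corner_integral_expansion\<close>) is Laplace's argument at the corner. On the box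
  \<open>{1..1 + \<epsilon>} \<times> {\<rho>..\<rho> + \<epsilon>}\<close> the power factor is almost constant, which costs \<open>\<theta>2\<close>. The remaining
  Gaussian is integrated first in \<open>y\<close> and then in \<open>x\<close>. Each time the integrand is compared with the
  derivative of \<open>- exp (- lam * (y\<^sup>2 - 2 * h * y))\<close>, that is, a factor \<open>2 * lam * (y - h)\<close> is replaced
  by its value at an end of the interval; this produces \<open>\<theta>3\<close>, \<open>\<theta>4\<close>, \<open>\<theta>5\<close> and then \<open>\<theta>6\<close>, \<open>\<theta>7\<close>. Outside the box
  the quadratic form exceeds its value at the corner by at least
  \<open>\<eta> = \<epsilon> * (2 * min (\<rho> - c) (1 - c * \<rho>) + \<epsilon>)\<close>. As \<open>lam > 1\<close>, the part \<open>lam - 1\<close> of the exponent can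
  be spent on this gap while the part \<open>1\<close> keeps the integral finite: the Gaussian with parameter
  \<open>1\<close> is integrated over the whole positive quadrant by completing the square, and this is the bound
  on \<open>I6\<close>.
\<close>

section \<open>Change of variables and Gamma integrals\<close>

text \<open>The substitution rule for the Henstock-Kurzweil integral, carried over to Borel functions and
  Lebesgue measure on the Borel sets. Integrability is part of the statement, so the two integrals
  agree also when they do not exist.\<close>

lemma set_lebesgue_integral_change_of_variables:
  fixes f g g' :: "real \<Rightarrow> real"
  assumes [measurable]: "f \<in> borel_measurable borel" "g \<in> borel_measurable borel"
      "g' \<in> borel_measurable borel" "S \<in> sets borel" "g ` S \<in> sets borel"
    and deriv: "\<And>x. x \<in> S \<Longrightarrow> (g has_field_derivative g' x) (at x within S)"
    and inj: "inj_on g S"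
  shows "set_integrable lborel (g ` S) f \<longleftrightarrow> set_integrable lborel S (\<lambda>x. \<bar>g' x\<bar> * f (g x))"
    and "(LBINT u:g ` S. f u) = (LBINT x:S. \<bar>g' x\<bar> * f (g x))"
proof -
  have S: "S \<in> sets lebesgue" by simp
  have borel_iff: "set_integrable lborel A h \<longleftrightarrow> h absolutely_integrable_on A"
    if [measurable]: "h \<in> borel_measurable borel" "A \<in> sets borel" for h :: "real \<Rightarrow> real" and A
    unfolding set_integrable_def by (subst integrable_completion) auto
  let ?h = "\<lambda>x. \<bar>g' x\<bar> * f (g x)"
  have cov: "?h absolutely_integrable_on S \<and> integral S ?h = b
      \<longleftrightarrow> f absolutely_integrable_on (g ` S) \<and> integral (g ` S) f = b" for b
    by (rule has_absolute_integral_change_of_variables_1'[OF S deriv inj])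
  show iff: "set_integrable lborel (g ` S) f \<longleftrightarrow> set_integrable lborel S ?h"
    using cov by (subst (1 2) borel_iff) auto
  show "(LBINT u:g ` S. f u) = (LBINT x:S. ?h x)"
  proof (cases "set_integrable lborel S ?h")
    case True
    then have "f absolutely_integrable_on (g ` S)" using iff borel_iff[of f "g ` S"] by auto
    then have "integral S ?h = integral (g ` S) f" using cov[of "integral (g ` S) f"] by simp
    then show ?thesis
      using True iff set_borel_integral_eq_integral(2)[of S ?h]
        set_borel_integral_eq_integral(2)[of "g ` S" f] by simp
  next
    case False
    then show ?thesis using iff
      by (auto simp: set_lebesgue_integral_def set_integrable_def not_integrable_integral_eq)
  qed
qed

lemma Gamma_half_plus_nat:
  "Gamma (real k + 1/2) * 4 ^ k * fact k = sqrt pi * fact (2 * k)"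
proof (induction k)
  case 0
  then show ?case by (simp add: Gamma_one_half_real)
next
  case (Suc k)
  have "real k + 1/2 \<notin> \<int>\<^sub>\<le>\<^sub>0" by (auto elim!: nonpos_Ints_cases)
  then have "Gamma (real (Suc k) + 1/2) = (real k + 1/2) * Gamma (real k + 1/2)"
    using Gamma_plus1[of "real k + 1/2"] by (simp add: add_ac)
  then have "Gamma (real (Suc k) + 1/2) * 4 ^ Suc k * fact (Suc k)
      = (real k + 1/2) * 4 * (real k + 1) * (Gamma (real k + 1/2) * 4 ^ k * fact k)"
    by (simp add: algebra_simps)
  also have "\<dots> = sqrt pi * ((2 * real k + 2) * (2 * real k + 1) * fact (2 * k))"
    unfolding Suc.IH by (simp add: algebra_simps)
  also have "(2 * real k + 2) * (2 * real k + 1) * fact (2 * k) = (fact (2 * Suc k) :: real)"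
    by (simp add: algebra_simps)
  finally show ?case .
qed

text \<open>These are the moments that integrate the power series of \<open>cosh (x * t)\<close> against
  \<open>(1 - t\<^sup>2) powr (a - 1)\<close>. They become Beta integrals under \<open>s = t\<^sup>2\<close>.\<close>

lemma
  fixes a :: real assumes a: "a > 0"
  shows even_moment_integrable: "integrable lborel (\<lambda>t. t ^ (2 * k) * (indicator {0<..<1} t * (1 - t\<^sup>2) powr (a - 1)))"
    and even_moment: "(LBINT t. t ^ (2 * k) * (indicator {0<..<1} t * (1 - t\<^sup>2) powr (a - 1)))
       = Beta (real k + 1/2) a / 2"
proof -
  let ?f = "\<lambda>s. s powr (real k + 1/2 - 1) * (1 - s) powr (a - 1)"
  let ?g = "\<lambda>t::real. t\<^sup>2"
  have img: "?g ` {0<..<1} = {0<..<1}"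
  proof (intro equalityI subsetI)
    fix y :: real assume "y \<in> {0<..<1}"
    then show "y \<in> ?g ` {0<..<1}" by (intro image_eqI[of _ _ "sqrt y"]) (auto simp: real_sqrt_lt_1_iff)
  next
    fix y :: real assume "y \<in> ?g ` {0<..<1}"
    then show "y \<in> {0<..<1}" by (auto simp: abs_square_less_1)
  qed
  have inj: "inj_on ?g {0<..<1}" by (auto intro!: inj_onI simp: power2_eq_iff)
  have d: "(?g has_field_derivative 2 * x) (at x within {0<..<1})" for x :: real
    by (auto intro!: derivative_eq_intros)
  have [measurable]: "?f \<in> borel_measurable borel" "?g \<in> borel_measurable borel"
    "(\<lambda>t::real. 2 * t) \<in> borel_measurable borel" by measurable
  have cov: "set_integrable lborel {0<..<1} ?f
        \<longleftrightarrow> set_integrable lborel {0<..<1} (\<lambda>t. \<bar>2 * t\<bar> * ?f (t\<^sup>2))"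
      "(LBINT s:{0<..<1}. ?f s) = (LBINT t:{0<..<1}. \<bar>2 * t\<bar> * ?f (t\<^sup>2))"
    using set_lebesgue_integral_change_of_variables[of ?f ?g "\<lambda>t. 2 * t" "{0<..<1}",
      unfolded img, OF _ _ _ _ _ d inj] by measurable
  have hi: "(?f has_integral Beta (real k + 1/2) a) {0<..<1}"
    using has_integral_Beta_real[of "real k + 1/2" a] a by (simp add: has_integral_Icc_iff_Ioo)
  have si: "set_integrable lborel {0<..<1} ?f"
    by (rule set_integrable_subset[OF integrable_Beta[of "real k + 1/2" a]]) (use a in auto)
  have eq: "indicator {0<..<1} t * (\<bar>2 * t\<bar> * ?f (t\<^sup>2))
      = 2 * (t ^ (2 * k) * (indicator {0<..<1} t * (1 - t\<^sup>2) powr (a - 1)))" for t :: real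
  proof (cases "t \<in> {0<..<1}")
    case True
    have "(t\<^sup>2) powr (real k + 1/2 - 1) * t = t powr (2 * (real k - 1/2)) * t powr 1"
      using True by (simp add: powr_powr flip: powr_numeral)
    also have "\<dots> = t powr real (2 * k)"
      unfolding powr_add[symmetric] by simp
    also have "\<dots> = t ^ (2 * k)" by (rule powr_realpow) (use True in simp)
    finally show ?thesis using True by (simp add: algebra_simps)
  qed auto
  have i2: "integrable lborel (\<lambda>t. 2 * (t ^ (2 * k) * (indicator {0<..<1} t * (1 - t\<^sup>2) powr (a - 1))))"
    using cov(1) si unfolding set_integrable_def real_scaleR_def eq by fast
  then show "integrable lborel (\<lambda>t. t ^ (2 * k) * (indicator {0<..<1} t * (1 - t\<^sup>2) powr (a - 1)))"
    by simp
  have "Beta (real k + 1/2) a = (LBINT s:{0<..<1}. ?f s)"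
    using set_borel_integral_eq_integral(2)[OF si] hi by (simp add: integral_unique)
  also have "\<dots> = (LBINT t. 2 * (t ^ (2 * k) * (indicator {0<..<1} t * (1 - t\<^sup>2) powr (a - 1))))"
    using cov(2) unfolding set_lebesgue_integral_def real_scaleR_def eq by simp
  finally show "(LBINT t. t ^ (2 * k) * (indicator {0<..<1} t * (1 - t\<^sup>2) powr (a - 1)))
       = Beta (real k + 1/2) a / 2" by simp
qed

section \<open>The Poisson integral of the Infeld function\<close>

abbreviation bessel_I_term :: "real \<Rightarrow> real \<Rightarrow> nat \<Rightarrow> real" where
  "bessel_I_term \<nu> x k \<equiv> (x / 2) powr (\<nu> + 2 * real k) / (Gamma (real k + 1) * Gamma (real k + \<nu> + 1))"

lemma cosh_even_sums: "(\<lambda>k. x ^ (2 * k) / fact (2 * k)) sums cosh (x :: real)"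
proof -
  have "strict_mono (\<lambda>k. 2 * k :: nat)" by (simp add: strict_mono_def)
  moreover have "(if even n then x ^ n /\<^sub>R fact n else 0) = 0" if "n \<notin> range (\<lambda>k. 2 * k)" for n
    using that by (auto elim: evenE)
  ultimately have "(\<lambda>k. if even (2 * k) then x ^ (2 * k) /\<^sub>R fact (2 * k) else 0) sums cosh x"
    using cosh_converges[of x]
      sums_mono_reindex[of "\<lambda>k. 2 * k" "\<lambda>n. if even n then x ^ n /\<^sub>R fact n else 0" "cosh x"]
    by blast
  then show ?thesis by (simp add: divide_inverse mult.commute)
qed

text \<open>Poisson's integral: the moments of the weight are Beta values, and by
  \<open>Gamma_half_plus_nat\<close> the factor \<open>(2 * k)!\<close> of the series of \<open>cosh\<close> combines with them to the
  terms of the Infeld series. The weight is folded onto \<open>{0<..<1}\<close>, so all terms are nonnegative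
  and the interchange of sum and integral needs only the convergence of the sum.\<close>

lemma
  fixes a x :: real assumes a: "a > 0" and x: "x > 0"
  defines "W \<equiv> \<lambda>t::real. indicator {0<..<1} t * (1 - t\<^sup>2) powr (a - 1)"
  shows cosh_moment_integrable: "integrable lborel (\<lambda>t. cosh (x * t) * W t)"
    and bessel_I_term_sums:
      "bessel_I_term (a - 1/2) x sums
         ((x / 2) powr (a - 1/2) / (sqrt pi * Gamma a) * (LBINT t. 2 * cosh (x * t) * W t))"
proof -
  define f where "f = (\<lambda>k t. (x ^ (2 * k) / fact (2 * k)) * (t ^ (2 * k) * W t))"
  have int: "integrable lborel (f k)" for k
    unfolding f_def W_def using even_moment_integrable[OF a] by (intro integrable_mult_right)
  have W0: "W t \<ge> 0" for t by (simp add: W_def)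
  have f0: "f k t \<ge> 0" for k t
    using x by (simp add: f_def W0)
  have intf: "integral\<^sup>L lborel (f k) = x ^ (2 * k) / fact (2 * k) * (Beta (real k + 1/2) a / 2)" for k
    unfolding f_def W_def integral_mult_right_zero even_moment[OF a] ..
  have s: "(\<lambda>k. f k t) sums (cosh (x * t) * W t)" for t
    using sums_mult2[OF cosh_even_sums[of "x * t"], of "W t"] 
    by (simp add: f_def power_mult_distrib mult_ac)
  have "summable (\<lambda>k. integral\<^sup>L lborel (f k))"
  proof (rule summable_comparison_test)
    show "summable (\<lambda>k. x ^ (2 * k) / fact (2 * k) * (Beta (1/2) a / 2))"
      using cosh_even_sums[of x] by (intro summable_mult2) (auto simp: sums_iff)
    have "t ^ (2 * k) * W t \<le> t ^ (2 * 0) * W t" for k t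
      by (cases "t \<in> {0<..<1}") (auto simp: W_def intro!: mult_left_le_one_le power_le_one)
    then have "(LBINT t. t ^ (2 * k) * W t) \<le> (LBINT t. t ^ (2 * 0) * W t)" for k
      using even_moment_integrable[OF a] unfolding W_def by (intro integral_mono)
    then have "Beta (real k + 1/2) a \<le> Beta (1/2) a" for k
      unfolding W_def even_moment[OF a] by simp
    then show "\<exists>N. \<forall>k\<ge>N. norm (integral\<^sup>L lborel (f k)) \<le> x ^ (2 * k) / fact (2 * k) * (Beta (1/2) a / 2)"
      using x f0 by (auto simp: integral_nonneg intf[symmetric] intro!: exI[of _ 0])
        (auto simp: intf intro!: divide_right_mono mult_left_mono)
  qed
  then have sn: "summable (\<lambda>k. \<integral>t. norm (f k t) \<partial>lborel)" using f0 by simp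
  have AEs: "AE t in lborel. summable (\<lambda>k. norm (f k t))"
    using f0 s by (auto simp: sums_iff)
  have sum_eq: "(\<lambda>t. \<Sum>k. f k t) = (\<lambda>t. cosh (x * t) * W t)"
    using s by (auto simp: sums_iff)
  show intc: "integrable lborel (\<lambda>t. cosh (x * t) * W t)"
    using integrable_suminf[OF int AEs sn] unfolding sum_eq .
  have "(\<lambda>k. integral\<^sup>L lborel (f k)) sums (LBINT t. cosh (x * t) * W t)"
    using sums_integral[OF int AEs sn] unfolding sum_eq .
  from sums_mult[OF this, of "(x / 2) powr (a - 1/2) / (sqrt pi * Gamma a) * 2"]
  have "(\<lambda>k. (x / 2) powr (a - 1/2) / (sqrt pi * Gamma a) * 2 * integral\<^sup>L lborel (f k)) sums
      ((x / 2) powr (a - 1/2) / (sqrt pi * Gamma a) * 2 * (LBINT t. cosh (x * t) * W t))" .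
  moreover have "(x / 2) powr (a - 1/2) / (sqrt pi * Gamma a) * 2 * integral\<^sup>L lborel (f k)
      = bessel_I_term (a - 1/2) x k" for k
  proof -
    define G1 G2 where "G1 = Gamma (real k + 1/2)" and "G2 = Gamma (real k + 1/2 + a)"
    have pos: "G1 > 0" "G2 > 0" "Gamma a > 0"
      using a unfolding G1_def G2_def by (auto intro!: Gamma_real_pos add_nonneg_pos add_pos_pos)
    have fact2k: "fact (2 * k) = G1 * 4 ^ k * fact k / sqrt pi"
      using Gamma_half_plus_nat[of k] unfolding G1_def by (simp add: field_simps)
    have "(x / 2) powr (a - 1/2) / (sqrt pi * Gamma a) * 2 * integral\<^sup>L lborel (f k)
       = (x / 2) powr (a - 1/2) * (x ^ (2 * k) / 4 ^ k) / (fact k * Gamma (real k + 1/2 + a))"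
      using pos unfolding intf Beta_def G1_def[symmetric] G2_def[symmetric] fact2k
      by (simp add: divide_simps)
    also have "x ^ (2 * k) / 4 ^ k = (x / 2) ^ (2 * k)" by (simp add: power_divide power_mult)
    also have "\<dots> = (x / 2) powr real (2 * k)" using x by (intro powr_realpow[symmetric]) simp
    also have "real (2 * k) = 2 * real k" by simp
    also have "(x / 2) powr (a - 1/2) * (x / 2) powr (2 * real k) = (x / 2) powr (a - 1/2 + 2 * real k)"
      by (simp add: powr_add)
    finally show ?thesis
      using Gamma_fact[of k, where 'a = real] by (simp add: add_ac)
  qed
  ultimately show "bessel_I_term (a - 1/2) x sums
         ((x / 2) powr (a - 1/2) / (sqrt pi * Gamma a) * (LBINT t. 2 * cosh (x * t) * W t))"
    by (simp add: mult.assoc)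
qed

text \<open>The Infeld function divided by its leading asymptotic term; it tends to \<open>1\<close> as \<open>x\<close> grows.\<close>

definition scaled_bessel :: "real \<Rightarrow> real \<Rightarrow> real" where
  "scaled_bessel \<nu> x = exp (- x) * sqrt (2 * pi * x) * bessel_I \<nu> x"

text \<open>Poisson's integral with \<open>v = x * (1 - t)\<close>, which measures the distance from the maximum of
  \<open>exp (x * t)\<close> at \<open>t = 1\<close> and makes the Gamma density \<open>exp (- v) * v powr (a - 1)\<close> appear. The two
  halves of \<open>cosh\<close> become the parts \<open>v < x\<close> and \<open>v > x\<close>.\<close>

lemma
  fixes a x :: real assumes a: "a > 0" and x: "x > 0"
  defines "h \<equiv> \<lambda>v. indicator {0<..<2 * x} v * (exp (- v) * v powr (a - 1) * (1 - v / (2 * x)) powr (a - 1))"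
  shows scaled_bessel_integrable: "integrable lborel h"
    and scaled_bessel_eq: "scaled_bessel (a - 1/2) x = (LBINT v. h v) / Gamma a"
proof -
  define W where "W = (\<lambda>t::real. indicator {0<..<1} t * (1 - t\<^sup>2) powr (a - 1))"
  have c: "integrable lborel (\<lambda>t. cosh (x * t) * W t)"
    unfolding W_def by (rule cosh_moment_integrable[OF a x])
  have [measurable]: "W \<in> borel_measurable borel" unfolding W_def by measurable
  have p: "integrable lborel (\<lambda>t. exp (x * t) * W t)"
    by (rule Bochner_Integration.integrable_bound[OF integrable_mult_right[OF c, of 2]])
      (auto simp: W_def cosh_def field_simps split: split_indicator intro!: AE_I2)
  have m: "integrable lborel (\<lambda>t. exp (- x * t) * W t)"
    by (rule Bochner_Integration.integrable_bound[OF integrable_mult_right[OF c, of 2]])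
      (auto simp: W_def cosh_def field_simps split: split_indicator intro!: AE_I2)
  have m': "integrable lborel (\<lambda>t. exp (x * t) * W (- t))"
    using lborel_integrable_real_affine[OF m, of "-1" 0] by simp
  define V where "V = (\<lambda>t::real. indicator {-1<..<1} t * (1 - t\<^sup>2) powr (a - 1))"
  have [measurable]: "V \<in> borel_measurable borel" unfolding V_def by measurable
  have "AE t in lborel. t \<noteq> (0::real)" by (rule AE_lborel_singleton)
  \<comment> \<open>the two halves of the weight omit only \<open>t = 0\<close>, a null set\<close>
  then have ae: "AE t in lborel. exp (x * t) * W t + exp (x * t) * W (- t) = exp (x * t) * V t"
    by eventually_elim (auto simp: W_def V_def split: split_indicator)
  have V: "integrable lborel (\<lambda>t. exp (x * t) * V t)"
    by (rule integrable_cong_AE_imp[OF Bochner_Integration.integrable_add[OF p m']])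
      (use ae in \<open>auto\<close>)
  have "(LBINT t. 2 * cosh (x * t) * W t) = (LBINT t. exp (x * t) * W t + exp (- x * t) * W t)"
    by (intro Bochner_Integration.integral_cong) (auto simp: cosh_def field_simps)
  also have "\<dots> = (LBINT t. exp (x * t) * W t) + (LBINT t. exp (- x * t) * W t)"
    by (intro Bochner_Integration.integral_add p m)
  also have "(LBINT t. exp (- x * t) * W t) = (LBINT t. exp (x * t) * W (- t))"
    using lborel_integral_real_affine[of "-1" "\<lambda>t. exp (- x * t) * W t" 0] by simp
  also have "(LBINT t. exp (x * t) * W t) + \<dots> = (LBINT t. exp (x * t) * W t + exp (x * t) * W (- t))"
    by (intro Bochner_Integration.integral_add[symmetric] p m')
  also have "\<dots> = (LBINT t. exp (x * t) * V t)"
    using ae by (intro integral_cong_AE) auto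
  finally have eq1: "(LBINT t. 2 * cosh (x * t) * W t) = (LBINT t. exp (x * t) * V t)" .
  have hV: "exp (x * (1 + (- 1 / x) * v)) * V (1 + (- 1 / x) * v)
      = exp x * (2 / x) powr (a - 1) * h v" for v
  proof (cases "v \<in> {0<..<2 * x}")
    case True
    have "1 - (1 + (- 1 / x) * v)\<^sup>2 = (2 / x) * (v * (1 - v / (2 * x)))"
      using x by (simp add: power2_eq_square field_simps)
    then have "(1 - (1 + (- 1 / x) * v)\<^sup>2) powr (a - 1)
        = (2 / x) powr (a - 1) * (v powr (a - 1) * (1 - v / (2 * x)) powr (a - 1))"
      using True x powr_mult[of "2 / x" "v * (1 - v / (2 * x))" "a - 1"]
        powr_mult[of v "1 - v / (2 * x)" "a - 1"] by (simp del: powr_mult)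
    moreover have "exp (x * (1 + (- 1 / x) * v)) = exp x * exp (- v)"
      using x by (simp add: algebra_simps flip: exp_add)
    moreover have "1 + (- 1 / x) * v \<in> {-1<..<1}" using True x by (auto simp: field_simps)
    ultimately show ?thesis using True by (simp add: V_def h_def)
  next
    case False
    have "1 + (- 1 / x) * v \<notin> {-1<..<1}" using False x by (auto simp: field_simps)
    then show ?thesis using False by (simp add: V_def h_def)
  qed
  have "integrable lborel (\<lambda>v. exp (x * (1 + (- 1 / x) * v)) * V (1 + (- 1 / x) * v))"
    using x by (intro lborel_integrable_real_affine[OF V]) auto
  then have "integrable lborel (\<lambda>v. exp x * (2 / x) powr (a - 1) * h v)" unfolding hV .
  then show "integrable lborel h" using x by simp
  have eq2: "(LBINT t. exp (x * t) * V t) = exp x * (2 / x) powr (a - 1) / x * (LBINT v. h v)"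
    using lborel_integral_real_affine[of "- 1 / x" "\<lambda>t. exp (x * t) * V t" 1] x
    unfolding hV by simp
  have "scaled_bessel (a - 1/2) x = exp (- x) * sqrt (2 * pi * x) *
      ((x / 2) powr (a - 1/2) / (sqrt pi * Gamma a) * (exp x * (2 / x) powr (a - 1) / x * (LBINT v. h v)))"
    using bessel_I_term_sums[OF a x] unfolding scaled_bessel_def bessel_I_def
    by (simp add: sums_iff eq1[unfolded W_def] eq2[unfolded W_def])
  also have "\<dots> = (exp (- x) * exp x) * (sqrt pi / sqrt pi) * (sqrt (2 * x) * (x / 2) powr (a - 1/2) * (2 / x) powr (a - 1) / x)
     * ((LBINT v. h v) / Gamma a)"
    by (simp add: real_sqrt_mult field_simps)
  also have "sqrt (2 * x) * (x / 2) powr (a - 1/2) * (2 / x) powr (a - 1) / x = 1"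
  proof -
    have "(2 / x) powr (a - 1) = (x / 2) powr (1 - a)"
      using x by (simp add: powr_divide powr_minus_divide[of _ "a - 1", simplified] field_simps)
    then have "(x / 2) powr (a - 1/2) * (2 / x) powr (a - 1) = (x / 2) powr (1/2)"
      by (simp flip: powr_add)
    also have "\<dots> = sqrt (x / 2)" using x by (simp add: powr_half_sqrt)
    finally have "sqrt (2 * x) * (x / 2) powr (a - 1/2) * (2 / x) powr (a - 1) / x
        = sqrt (2 * x) * sqrt (x / 2) / x" by (simp add: mult_ac)
    also have "\<dots> = 1" using x by (simp flip: real_sqrt_mult)
    finally show ?thesis .
  qed
  also have "exp (- x) * exp x = 1" by (simp flip: exp_add)
  finally show "scaled_bessel (a - 1/2) x = (LBINT v. h v) / Gamma a" by simp
qed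

lemma
  fixes s :: real assumes "s > 0"
  shows Gamma_integrand_integrable: "integrable lborel (\<lambda>v. indicator {0<..} v * (exp (- v) * v powr (s - 1)))"
    and Gamma_lebesgue_integral: "(LBINT v. indicator {0<..} v * (exp (- v) * v powr (s - 1))) = Gamma s"
proof -
  let ?f = "\<lambda>v::real. indicator {0<..} v * (exp (- v) * v powr (s - 1))"
  have "(\<integral>\<^sup>+v. ennreal (?f v) \<partial>lborel) = (\<integral>\<^sup>+v. ennreal (indicator {0..} v * v powr (s - 1) / exp v) \<partial>lborel)"
    by (intro nn_integral_cong) (auto simp: exp_minus field_simps indicator_def)
  then have "(\<integral>\<^sup>+v. ennreal (?f v) \<partial>lborel) = ennreal (Gamma s)"
    using Gamma_conv_nn_integral_real[OF assms] by simp
  then have "has_bochner_integral lborel ?f (Gamma s)"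
    using assms by (intro has_bochner_integral_nn_integral) (auto intro: less_imp_le)
  then show "integrable lborel ?f" "integral\<^sup>L lborel ?f = Gamma s"
    by (auto simp: has_bochner_integral_iff)
qed

text \<open>The mean of \<open>p0 + p1 * Y + p2 * Y\<^sup>2 + p3 * Y ^ 3\<close> when \<open>2 * x * Y\<close> has the Gamma distribution of
  shape \<open>a\<close>; see \<open>gamma_cubic_integral\<close>.\<close>

definition gamma_cubic_mean :: "real \<Rightarrow> real \<Rightarrow> (real \<times> real \<times> real \<times> real) \<Rightarrow> real" where
  "gamma_cubic_mean a x = (\<lambda>(p0, p1, p2, p3). p0 + p1 * a / (2 * x) + p2 * (a * (a + 1)) / (4 * x\<^sup>2)
      + p3 * (a * (a + 1) * (a + 2)) / (8 * x ^ 3))"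

lemma
  fixes a x p0 p1 p2 p3 :: real assumes a: "a > 0" and x: "x > 0"
  defines "P \<equiv> \<lambda>y. p0 + p1 * y + p2 * y\<^sup>2 + p3 * y ^ 3"
  shows gamma_cubic_integrable:
      "integrable lborel (\<lambda>v. indicator {0<..} v * (exp (- v) * v powr (a - 1)) * P (v / (2 * x)))"
    and gamma_cubic_integral:
      "(LBINT v. indicator {0<..} v * (exp (- v) * v powr (a - 1)) * P (v / (2 * x)))
        = Gamma a * gamma_cubic_mean a x (p0, p1, p2, p3)"
proof -
  define g where "g = (\<lambda>s v::real. indicator {0<..} v * (exp (- v) * v powr (s - 1)))"
  have g: "integrable lborel (g s)" "integral\<^sup>L lborel (g s) = Gamma s" if "s > 0" for s
    using Gamma_integrand_integrable[OF that] Gamma_lebesgue_integral[OF that] by (auto simp: g_def)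
  have G: "Gamma (a + 1) = a * Gamma a" "Gamma (a + 2) = a * (a + 1) * Gamma a"
      "Gamma (a + 3) = a * (a + 1) * (a + 2) * Gamma a"
  proof -
    have *: "Gamma (s + 1) = s * Gamma s" if "s > 0" for s :: real
      using that by (intro Gamma_plus1) (auto elim!: nonpos_Ints_cases)
    show "Gamma (a + 1) = a * Gamma a" using *[OF a] .
    then show "Gamma (a + 2) = a * (a + 1) * Gamma a" using *[of "a + 1"] a by (simp add: add_ac)
    then show "Gamma (a + 3) = a * (a + 1) * (a + 2) * Gamma a" using *[of "a + 2"] a by (simp add: add_ac)
  qed
  have eq: "(\<lambda>v. g a v * P (v / (2 * x))) =
     (\<lambda>v. p0 * g a v + p1 / (2 * x) * g (a + 1) v + p2 / (4 * x\<^sup>2) * g (a + 2) v + p3 / (8 * x ^ 3) * g (a + 3) v)"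
  proof
    fix v
    have shift: "g (a + real k) v = g a v * v ^ k" for k :: nat
    proof (cases "v > 0")
      case True
      have "v powr (a + real k - 1) = v powr (a - 1 + real k)" by (simp add: algebra_simps)
      also have "\<dots> = v powr (a - 1) * v ^ k" using True by (simp only: powr_add powr_realpow)
      finally show ?thesis by (simp add: g_def)
    qed (simp add: g_def)
    show "g a v * P (v / (2 * x)) =
     p0 * g a v + p1 / (2 * x) * g (a + 1) v + p2 / (4 * x\<^sup>2) * g (a + 2) v + p3 / (8 * x ^ 3) * g (a + 3) v"
      using shift[of 1] shift[of 2] shift[of 3]
      by (simp add: P_def power_divide power_mult_distrib distrib_left mult_ac)
  qed
  have "integrable lborel (\<lambda>v. g a v * P (v / (2 * x)))"
    unfolding eq using a by (intro Bochner_Integration.integrable_add integrable_mult_right g) auto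
  then show "integrable lborel (\<lambda>v. indicator {0<..} v * (exp (- v) * v powr (a - 1)) * P (v / (2 * x)))"
    by (simp add: g_def)
  have "(LBINT v. g a v * P (v / (2 * x))) = p0 * Gamma a + p1 / (2 * x) * Gamma (a + 1)
      + p2 / (4 * x\<^sup>2) * Gamma (a + 2) + p3 / (8 * x ^ 3) * Gamma (a + 3)"
    unfolding eq using a g by simp
  also have "\<dots> = Gamma a * gamma_cubic_mean a x (p0, p1, p2, p3)"
    unfolding G gamma_cubic_mean_def prod.case by (simp add: algebra_simps add_divide_distrib)
  finally show "(LBINT v. indicator {0<..} v * (exp (- v) * v powr (a - 1)) * P (v / (2 * x)))
        = Gamma a * gamma_cubic_mean a x (p0, p1, p2, p3)" by (simp add: g_def)
qed

text \<open>The Gamma integral runs over all \<open>v > 0\<close>, Poisson's integral only up to \<open>v = 2 * x\<close>. This is why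
  the polynomial must be controlled in sign beyond \<open>y = 1\<close>.\<close>

lemma scaled_bessel_le_gamma_cubic_mean:
  fixes a x :: real
  assumes a: "a > 0" and x: "x > 0"
    and inside: "\<And>y. 0 < y \<Longrightarrow> y < 1 \<Longrightarrow> (1 - y) powr (a - 1) \<le> p0 + p1 * y + p2 * y\<^sup>2 + p3 * y ^ 3"
    and outside: "\<And>y. 1 \<le> y \<Longrightarrow> 0 \<le> p0 + p1 * y + p2 * y\<^sup>2 + p3 * y ^ 3"
  shows "scaled_bessel (a - 1/2) x \<le> gamma_cubic_mean a x (p0, p1, p2, p3)"
proof -
  have "(LBINT v. indicator {0<..<2 * x} v * (exp (- v) * v powr (a - 1) * (1 - v / (2 * x)) powr (a - 1)))
     \<le> (LBINT v. indicator {0<..} v * (exp (- v) * v powr (a - 1)) *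
          (p0 + p1 * (v / (2 * x)) + p2 * (v / (2 * x))\<^sup>2 + p3 * (v / (2 * x)) ^ 3))"
  proof (intro integral_mono scaled_bessel_integrable gamma_cubic_integrable a x)
    fix v :: real
    consider "v \<le> 0" | "0 < v" "v < 2 * x" | "2 * x \<le> v" by linarith
    then show "indicator {0<..<2 * x} v * (exp (- v) * v powr (a - 1) * (1 - v / (2 * x)) powr (a - 1))
      \<le> indicator {0<..} v * (exp (- v) * v powr (a - 1)) *
          (p0 + p1 * (v / (2 * x)) + p2 * (v / (2 * x))\<^sup>2 + p3 * (v / (2 * x)) ^ 3)"
    proof cases
      case 2
      then have "0 < v / (2 * x)" "v / (2 * x) < 1" using x by auto
      from mult_left_mono[OF inside[OF this], of "exp (- v) * v powr (a - 1)"]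
      show ?thesis using 2 by (simp add: mult.assoc)
    next
      case 3
      then have "0 \<le> indicator {0<..} v * (exp (- v) * v powr (a - 1)) *
          (p0 + p1 * (v / (2 * x)) + p2 * (v / (2 * x))\<^sup>2 + p3 * (v / (2 * x)) ^ 3)"
        using x by (intro mult_nonneg_nonneg outside) auto
      then show ?thesis using 3 by simp
    qed auto
  qed
  then show ?thesis
    using a unfolding scaled_bessel_eq[OF a x] gamma_cubic_integral[OF a x]
    by (simp add: divide_le_eq mult.commute)
qed

lemma gamma_cubic_mean_le_scaled_bessel:
  fixes a x :: real
  assumes a: "a > 0" and x: "x > 0"
    and inside: "\<And>y. 0 < y \<Longrightarrow> y < 1 \<Longrightarrow> p0 + p1 * y + p2 * y\<^sup>2 + p3 * y ^ 3 \<le> (1 - y) powr (a - 1)"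
    and outside: "\<And>y. 1 \<le> y \<Longrightarrow> p0 + p1 * y + p2 * y\<^sup>2 + p3 * y ^ 3 \<le> 0"
  shows "gamma_cubic_mean a x (p0, p1, p2, p3) \<le> scaled_bessel (a - 1/2) x"
proof -
  have "(LBINT v. indicator {0<..} v * (exp (- v) * v powr (a - 1)) *
          (p0 + p1 * (v / (2 * x)) + p2 * (v / (2 * x))\<^sup>2 + p3 * (v / (2 * x)) ^ 3))
     \<le> (LBINT v. indicator {0<..<2 * x} v * (exp (- v) * v powr (a - 1) * (1 - v / (2 * x)) powr (a - 1)))"
  proof (intro integral_mono scaled_bessel_integrable gamma_cubic_integrable a x)
    fix v :: real
    consider "v \<le> 0" | "0 < v" "v < 2 * x" | "2 * x \<le> v" by linarith
    then show "indicator {0<..} v * (exp (- v) * v powr (a - 1)) *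
          (p0 + p1 * (v / (2 * x)) + p2 * (v / (2 * x))\<^sup>2 + p3 * (v / (2 * x)) ^ 3)
        \<le> indicator {0<..<2 * x} v * (exp (- v) * v powr (a - 1) * (1 - v / (2 * x)) powr (a - 1))"
    proof cases
      case 2
      then have "0 < v / (2 * x)" "v / (2 * x) < 1" using x by auto
      from mult_left_mono[OF inside[OF this], of "exp (- v) * v powr (a - 1)"]
      show ?thesis using 2 by (simp add: mult.assoc)
    next
      case 3
      then have "indicator {0<..} v * (exp (- v) * v powr (a - 1)) *
          (p0 + p1 * (v / (2 * x)) + p2 * (v / (2 * x))\<^sup>2 + p3 * (v / (2 * x)) ^ 3) \<le> 0"
        using x by (intro mult_nonneg_nonpos outside) auto
      then show ?thesis using 3 by simp
    qed auto
  qed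
  then show ?thesis
    using a unfolding scaled_bessel_eq[OF a x] gamma_cubic_integral[OF a x]
    by (simp add: le_divide_eq mult.commute)
qed

section \<open>The Infeld function against its leading asymptotic term\<close>

text \<open>Both sides agree at \<open>y = 0\<close>, and \<open>(1 - t) powr m + m * t\<close> is nondecreasing on \<open>{0..<1}\<close>.\<close>

lemma bernoulli_powr_one_minus:
  fixes y m :: real assumes m: "m \<ge> 1" and y: "0 < y" "y < 1"
  shows "1 - m * y \<le> (1 - y) powr m"
proof -
  have "((\<lambda>t. (1 - t) powr m + m * t) has_real_derivative (m * (1 - (1 - t) powr (m - 1)))) (at t)"
    if "0 \<le> t" "t < 1" for t
    using that by (auto intro!: derivative_eq_intros simp: algebra_simps)
  moreover have "m * (1 - (1 - t) powr (m - 1)) \<ge> 0" if "0 \<le> t" "t < 1" for t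
    using that m by (intro mult_nonneg_nonneg) (auto intro!: powr_le1)
  ultimately have "\<exists>d. ((\<lambda>t. (1 - t) powr m + m * t) has_real_derivative d) (at t) \<and> d \<ge> 0"
    if "0 \<le> t" "t \<le> y" for t
    using that y by (intro exI[of _ "m * (1 - (1 - t) powr (m - 1))"]) auto
  then have "(1 - 0) powr m + m * 0 \<le> (1 - y) powr m + m * y"
    using y by (intro DERIV_nonneg_imp_nondecreasing[of 0 y "\<lambda>t. (1 - t) powr m + m * t"]) auto
  then show ?thesis by simp
qed

lemma scaled_bessel_le_1:
  assumes "a \<ge> 1" "x > 0" shows "scaled_bessel (a - 1/2) x \<le> 1"
proof -
  have "scaled_bessel (a - 1/2) x \<le> gamma_cubic_mean a x (1, 0, 0, 0)"
    using assms by (intro scaled_bessel_le_gamma_cubic_mean) (auto intro!: powr_le1)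
  then show ?thesis by (simp add: gamma_cubic_mean_def)
qed

lemma scaled_bessel_ge_first_order:
  assumes "a \<ge> 2" "x > 0" shows "1 - (a - 1) * a / (2 * x) \<le> scaled_bessel (a - 1/2) x"
proof -
  have outside: "1 - (a - 1) * y \<le> 0" if "y \<ge> 1" for y
    using mult_mono[of 1 "a - 1" 1 y] assms that by simp
  have "gamma_cubic_mean a x (1, - (a - 1), 0, 0) \<le> scaled_bessel (a - 1/2) x"
  proof (rule gamma_cubic_mean_le_scaled_bessel)
    fix y :: real
    show "1 + - (a - 1) * y + 0 * y\<^sup>2 + 0 * y ^ 3 \<le> (1 - y) powr (a - 1)" if "0 < y" "y < 1"
      using bernoulli_powr_one_minus[of "a - 1" y] assms that unfolding mult_minus_left by simp
    show "1 + - (a - 1) * y + 0 * y\<^sup>2 + 0 * y ^ 3 \<le> 0" if "1 \<le> y"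
      using outside[OF that] unfolding mult_minus_left by simp
  qed (use assms in auto)
  then show ?thesis
    unfolding gamma_cubic_mean_def prod.case mult_minus_left minus_divide_left[symmetric] by simp
qed

text \<open>For \<open>\<nu> = 1/2\<close> the power \<open>(1 - v / (2 * x)) powr 0\<close> is constant, and the Gamma distribution of shape
  \<open>1\<close> is the exponential one.\<close>

lemma scaled_bessel_half:
  assumes x: "x > 0" shows "scaled_bessel (1/2) x = 1 - exp (- 2 * x)"
proof -
  have "(LBINT v. indicator {0<..<2 * x} v * (exp (- v) * v powr (1 - 1) * (1 - v / (2 * x)) powr (1 - 1)))
      = (LBINT v. indicator {0..2 * x} v *\<^sub>R exp (- v))"
  proof (rule integral_cong_AE)
    have "AE v in lborel. v \<noteq> (0::real)" "AE v in lborel. v \<noteq> 2 * x" by (rule AE_lborel_singleton)+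
    then show "AE v in lborel. indicator {0<..<2 * x} v * (exp (- v) * v powr (1 - 1) * (1 - v / (2 * x)) powr (1 - 1))
      = indicator {0..2 * x} v *\<^sub>R exp (- v)"
      by eventually_elim (use x in \<open>auto simp: indicator_def\<close>)
  qed auto
  also have "\<dots> = - exp (- (2 * x)) - (- exp (- 0))"
    using x by (intro integral_FTC_Icc) (auto intro!: derivative_eq_intros continuous_intros simp: has_real_derivative_iff_has_vector_derivative[symmetric])
  finally show ?thesis using scaled_bessel_eq[of 1 x] x by simp
qed

text \<open>In terms of \<open>w = sqrt (1 - y)\<close> each inequality becomes a polynomial one whose difference has a
  multiple zero at \<open>w = 1\<close>, that is at \<open>y = 0\<close>, and a cofactor with nonnegative coefficients. The
  polynomials start with the Taylor expansion at \<open>y = 0\<close>; the last coefficient is a round number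
  that makes the inequality hold up to \<open>y = 1\<close> and gives the polynomial the right sign beyond.\<close>

lemma
  fixes y :: real assumes y: "0 < y" "y < 1"
  shows powr_half_le: "(1 - y) powr (1/2) \<le> 1 - y / 2 + y\<^sup>2 / 16"
    and powr_half_ge: "1 - y / 2 - y\<^sup>2 / 2 \<le> (1 - y) powr (1/2)"
    and powr_three_halves_le: "(1 - y) powr (3/2) \<le> 1 - 3/2 * y + 3/8 * y\<^sup>2 + y ^ 3 / 6"
    and powr_three_halves_ge: "1 - 3/2 * y + 3/8 * y\<^sup>2 - y ^ 3 / 8 \<le> (1 - y) powr (3/2)"
proof -
  define w where "w = sqrt (1 - y)"
  have w: "0 < w" "w < 1" and y_eq: "y = 1 - w\<^sup>2" using y by (auto simp: w_def)
  have half: "(1 - y) powr (1/2) = w" using y by (simp add: w_def powr_half_sqrt)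
  have "(1 - y) powr (3/2) = (1 - y) powr (1 + 1/2)" by simp
  also have "\<dots> = (1 - y) * w" using y unfolding powr_add half by simp
  also have "\<dots> = w ^ 3" by (simp add: y_eq power2_eq_square power3_eq_cube)
  finally have th: "(1 - y) powr (3/2) = w ^ 3" .
  have "1 - y / 2 + y\<^sup>2 / 16 - w = (1 - w)\<^sup>2 * (w\<^sup>2 + 2 * w + 9) / 16"
    by (simp add: y_eq field_simps power2_eq_square)
  also have "\<dots> \<ge> 0" using w by simp
  finally show "(1 - y) powr (1/2) \<le> 1 - y / 2 + y\<^sup>2 / 16" unfolding half by simp
  have "w - (1 - y / 2 - y\<^sup>2 / 2) = w * (1 - w)\<^sup>2 * (w + 2) / 2"
    by (simp add: y_eq field_simps power2_eq_square)
  also have "\<dots> \<ge> 0" using w by simp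
  finally show "1 - y / 2 - y\<^sup>2 / 2 \<le> (1 - y) powr (1/2)" unfolding half by simp
  have "1 - 3/2 * y + 3/8 * y\<^sup>2 + y ^ 3 / 6 - w ^ 3
      = (1 - w) ^ 3 * (1 + 3 * w + 12 * w\<^sup>2 + 4 * w ^ 3) / 24"
    by (simp add: y_eq field_simps power2_eq_square power3_eq_cube)
  also have "\<dots> \<ge> 0" using w by simp
  finally show "(1 - y) powr (3/2) \<le> 1 - 3/2 * y + 3/8 * y\<^sup>2 + y ^ 3 / 6" unfolding th by simp
  have "w ^ 3 - (1 - 3/2 * y + 3/8 * y\<^sup>2 - y ^ 3 / 8)
      = (1 - w) ^ 3 * (2 + 6 * w + 3 * w\<^sup>2 + w ^ 3) / 8"
    by (simp add: y_eq field_simps power2_eq_square power3_eq_cube)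
  also have "\<dots> \<ge> 0" using w by simp
  finally show "1 - 3/2 * y + 3/8 * y\<^sup>2 - y ^ 3 / 8 \<le> (1 - y) powr (3/2)" unfolding th by simp
qed

lemma scaled_bessel_1_le:
  assumes x: "x > 0" shows "scaled_bessel 1 x \<le> 1 - 3 / (8 * x) + 15 / (256 * x\<^sup>2)"
proof -
  have "scaled_bessel (3/2 - 1/2) x \<le> gamma_cubic_mean (3/2) x (1, - 1/2, 1/16, 0)"
  proof (rule scaled_bessel_le_gamma_cubic_mean)
    fix y :: real
    show "0 \<le> 1 + - 1/2 * y + 1/16 * y\<^sup>2 + 0 * y ^ 3"
      using zero_le_power2[of "1 - y / 4"] by (simp add: power2_eq_square field_simps)
  qed (use x powr_half_le in auto)
  then show ?thesis by (simp add: gamma_cubic_mean_def)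
qed

lemma scaled_bessel_1_ge:
  assumes x: "x > 0" shows "1 - 3 / (8 * x) - 15 / (32 * x\<^sup>2) \<le> scaled_bessel 1 x"
proof -
  have "gamma_cubic_mean (3/2) x (1, - 1/2, - 1/2, 0) \<le> scaled_bessel (3/2 - 1/2) x"
  proof (rule gamma_cubic_mean_le_scaled_bessel)
    fix y :: real assume y: "1 \<le> y"
    then have "1 * 1 \<le> y * y" by (intro mult_mono) auto
    then show "1 + - 1/2 * y + - 1/2 * y\<^sup>2 + 0 * y ^ 3 \<le> 0"
      using y by (simp add: power2_eq_square)
  qed (use x powr_half_ge in auto)
  then show ?thesis by (simp add: gamma_cubic_mean_def)
qed

lemma scaled_bessel_2_le:
  assumes x: "x > 0"
  shows "scaled_bessel 2 x \<le> 1 - 15 / (8 * x) + 105 / (128 * x\<^sup>2) + 105 / (128 * x ^ 3)"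
proof -
  have "scaled_bessel (5/2 - 1/2) x \<le> gamma_cubic_mean (5/2) x (1, - 3/2, 3/8, 1/6)"
  proof (rule scaled_bessel_le_gamma_cubic_mean)
    fix y :: real
    show "(1 - y) powr (5/2 - 1) \<le> 1 + - 3/2 * y + 3/8 * y\<^sup>2 + 1/6 * y ^ 3" if "0 < y" "y < 1"
      using powr_three_halves_le[OF that] by simp
    assume y: "1 \<le> y"
    have "1 + - 3/2 * y + 3/8 * y\<^sup>2 + 1/6 * y ^ 3
        = (y - 1) ^ 3 / 6 + 7/8 * (y - 1 - 1/7)\<^sup>2 + 1/42"
      by (simp add: power2_eq_square power3_eq_cube field_simps)
    also have "\<dots> \<ge> 0" using y by simp
    finally show "0 \<le> 1 + - 3/2 * y + 3/8 * y\<^sup>2 + 1/6 * y ^ 3" .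
  qed (use x in auto)
  then show ?thesis by (simp add: gamma_cubic_mean_def)
qed

lemma scaled_bessel_2_ge:
  assumes x: "x > 0"
  shows "1 - 15 / (8 * x) + 105 / (128 * x\<^sup>2) - 315 / (512 * x ^ 3) \<le> scaled_bessel 2 x"
proof -
  have "gamma_cubic_mean (5/2) x (1, - 3/2, 3/8, - 1/8) \<le> scaled_bessel (5/2 - 1/2) x"
  proof (rule gamma_cubic_mean_le_scaled_bessel)
    fix y :: real
    show "1 + - 3/2 * y + 3/8 * y\<^sup>2 + - 1/8 * y ^ 3 \<le> (1 - y) powr (5/2 - 1)" if "0 < y" "y < 1"
      using powr_three_halves_ge[OF that] by simp
    assume y: "1 \<le> y"
    have "1 + - 3/2 * y + 3/8 * y\<^sup>2 + - 1/8 * y ^ 3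
        = - ((y - 1) ^ 3 / 8 + 9/8 * (y - 1) + 1/4)"
      by (simp add: power2_eq_square power3_eq_cube field_simps)
    also have "\<dots> \<le> 0"
      unfolding neg_le_0_iff_le using y
      by (intro add_nonneg_nonneg mult_nonneg_nonneg divide_nonneg_nonneg zero_le_power) auto
    finally show "1 + - 3/2 * y + 3/8 * y\<^sup>2 + - 1/8 * y ^ 3 \<le> 0" .
  qed (use x in auto)
  then show ?thesis by (simp add: gamma_cubic_mean_def)
qed

text \<open>In the power series, the term of index \<open>k + 1\<close> on the left equals the term of index \<open>k\<close> of \<open>I\<^sub>2\<close>
  plus the term of index \<open>k + 1\<close> of \<open>(2 / x) * I\<^sub>1\<close>; the first terms of \<open>I\<^sub>0\<close> and \<open>(2 / x) * I\<^sub>1\<close>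
  agree.\<close>

lemma bessel_I_recurrence:
  assumes x: "x > 0" shows "bessel_I 0 x = bessel_I 2 x + 2 / x * bessel_I 1 x"
proof -
  have s: "summable (bessel_I_term \<nu> x)" if "\<nu> > - 1/2" for \<nu>
    using bessel_I_term_sums[of "\<nu> + 1/2" x] that x by (simp add: sums_iff)
  have Gn: "Gamma (real k + 1) = fact k" "Gamma (real k + 2) = (real k + 1) * fact k"
     "Gamma (real k + 3) = (real k + 2) * (real k + 1) * fact k" for k
    using Gamma_fact[of k, where 'a = real] Gamma_fact[of "Suc k", where 'a = real]
      Gamma_fact[of "Suc (Suc k)", where 'a = real] by (simp_all add: add_ac)
  define y where "y = x / 2"
  have y: "y > 0" using x by (simp add: y_def)
  have pw: "y powr (real n + 2 * real k) = y ^ n * y ^ (2 * k)" for n k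
    using y powr_realpow[of y "n + 2 * k"] by (simp add: power_add)
  have T0: "bessel_I_term 0 x k = y ^ (2 * k) / (fact k)\<^sup>2" for k
    using pw[of 0 k] Gn(1)[of k] by (simp add: y_def[symmetric] power2_eq_square)
  have T1: "bessel_I_term 1 x k = y * y ^ (2 * k) / ((real k + 1) * (fact k)\<^sup>2)" for k
    using pw[of 1 k] Gn(1,2)[of k] by (simp add: y_def[symmetric] power2_eq_square add_ac)
  have T2: "bessel_I_term 2 x k = y\<^sup>2 * y ^ (2 * k) / ((real k + 2) * (real k + 1) * (fact k)\<^sup>2)" for k
    using pw[of 2 k] Gn(1,3)[of k] by (simp add: y_def[symmetric] power2_eq_square add_ac)
  have step: "bessel_I_term 0 x (Suc k) = bessel_I_term 2 x k + 2 / x * bessel_I_term 1 x (Suc k)" for k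
  proof -
    have xy: "2 / x = 1 / y" by (simp add: y_def)
    have f: "fact (Suc k) = (real k + 1) * fact k" by simp
    have nz: "y \<noteq> 0" "real k + 1 \<noteq> 0" "real k + 2 \<noteq> 0" "fact k \<noteq> (0::real)" using y by auto
    have "y\<^sup>2 * Y / ((real k + 2) * (real k + 1) * F\<^sup>2) + 1 / y * (y * (y\<^sup>2 * Y) / ((real k + 2) * ((real k + 1) * F)\<^sup>2))
       = y\<^sup>2 * Y / ((real k + 1) * F)\<^sup>2" if "F \<noteq> 0" for Y F :: real
      using nz that by (simp add: divide_simps power2_eq_square) (simp add: algebra_simps)
    from this[of "fact k" "y ^ (2 * k)"] show ?thesis
      unfolding T0 T1 T2 xy f by (simp add: power2_eq_square add_ac)
  qed
  have "bessel_I 0 x = bessel_I_term 0 x 0 + (\<Sum>k. bessel_I_term 0 x (Suc k))"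
    unfolding bessel_I_def using suminf_split_head[OF s[of 0]] by simp
  also have "(\<Sum>k. bessel_I_term 0 x (Suc k)) = (\<Sum>k. bessel_I_term 2 x k + 2 / x * bessel_I_term 1 x (Suc k))"
    unfolding step ..
  also have "\<dots> = (\<Sum>k. bessel_I_term 2 x k) + 2 / x * (\<Sum>k. bessel_I_term 1 x (Suc k))"
  proof -
    have s1: "summable (\<lambda>k. bessel_I_term 1 x (Suc k))"
      using s[of 1] by (subst summable_Suc_iff) simp
    show ?thesis
      unfolding suminf_mult[OF s1, symmetric]
      by (intro suminf_add[symmetric] summable_mult s1 s) auto
  qed
  also have "(\<Sum>k. bessel_I_term 1 x (Suc k)) = bessel_I 1 x - bessel_I_term 1 x 0"
    unfolding bessel_I_def using suminf_split_head[OF s[of 1]] by simp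
  also have "2 / x * (bessel_I 1 x - bessel_I_term 1 x 0) = 2 / x * bessel_I 1 x - bessel_I_term 0 x 0"
    unfolding T0 T1 using y by (simp add: right_diff_distrib) (simp add: y_def)
  finally show ?thesis unfolding bessel_I_def by simp
qed

lemma scaled_bessel_recurrence:
  assumes x: "x > 0" shows "scaled_bessel 0 x = scaled_bessel 2 x + 2 / x * scaled_bessel 1 x"
  unfolding scaled_bessel_def bessel_I_recurrence[OF x] by (simp add: algebra_simps)

text \<open>Insert the bounds for \<open>\<nu> = 1\<close> and \<open>\<nu> = 2\<close> into the recurrence. The combination is a polynomial in
  \<open>r = 1 / x\<close> whose linear part is exactly \<open>r / 8\<close>. The factor after \<open>9 / (32 * x\<^sup>2)\<close> is the product
  \<open>(1 + 3 / (4 * x)) * (1 + 2 / x)\<close>, a lower bound for \<open>G_fun 0 x\<close> when \<open>x > 3/4\<close>.\<close>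

lemma scaled_bessel_0_bound:
  assumes large: "x \<ge> 3/4"
  shows "\<bar>scaled_bessel 0 x - 1\<bar> \<le> 1 / (8 * x) + 9 / (32 * x\<^sup>2) * (1 + 11 / (4 * x) + 3 / (2 * x\<^sup>2))"
proof -
  define r where "r = 1 / x"
  have x: "x > 0" and r: "r > 0" "r \<le> 4/3" using large by (auto simp: r_def field_simps)
  have R1: "1 - 3/8 * r - 15/32 * r\<^sup>2 \<le> scaled_bessel 1 x" "scaled_bessel 1 x \<le> 1 - 3/8 * r + 15/256 * r\<^sup>2"
    using scaled_bessel_1_ge[OF x] scaled_bessel_1_le[OF x] by (simp_all add: r_def power_divide)
  have R2: "1 - 15/8 * r + 105/128 * r\<^sup>2 - 315/512 * r ^ 3 \<le> scaled_bessel 2 x"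
     "scaled_bessel 2 x \<le> 1 - 15/8 * r + 105/128 * r\<^sup>2 + 105/128 * r ^ 3"
    using scaled_bessel_2_ge[OF x] scaled_bessel_2_le[OF x] by (simp_all add: r_def power_divide)
  have R0: "scaled_bessel 0 x = scaled_bessel 2 x + 2 * r * scaled_bessel 1 x"
    using scaled_bessel_recurrence[OF x] by (simp add: r_def)
  define B where "B = r / 8 + 9/32 * r\<^sup>2 * (1 + 11/4 * r + 3/2 * r\<^sup>2)"
  have "scaled_bessel 0 x - 1 \<le> (- 15/8 * r + 105/128 * r\<^sup>2 + 105/128 * r ^ 3) + 2 * r * (1 - 3/8 * r + 15/256 * r\<^sup>2)"
    unfolding R0 using R2(2) mult_left_mono[OF R1(2), of "2 * r"] r by linarith
  \<comment> \<open>the difference to \<open>B\<close> is \<open>r\<^sup>2\<close> times a positive quadratic, written with its square completed\<close>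
  also have "\<dots> = B - r\<^sup>2 * (54 * (r - 7/36)\<^sup>2 + 599/24) / 128"
    by (simp add: B_def power2_eq_square power3_eq_cube field_simps)
  also have "\<dots> \<le> B" using r by simp
  finally have up: "scaled_bessel 0 x - 1 \<le> B" .
  \<comment> \<open>here \<open>r \<le> 4/3\<close> enters: the quadratic \<open>216 * r\<^sup>2 - 399 * r + 180\<close> has minimum \<open>- 409/96\<close>\<close>
  have "- B \<le> - B + r * (216 * r * (r - 133/144)\<^sup>2 + (128 - 409/96 * r)) / 512"
    using r by (simp add: add_nonneg_nonneg)
  also have "\<dots> = (- 15/8 * r + 105/128 * r\<^sup>2 - 315/512 * r ^ 3) + 2 * r * (1 - 3/8 * r - 15/32 * r\<^sup>2)"
    by (simp add: B_def power2_eq_square power3_eq_cube field_simps)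
  also have "\<dots> \<le> scaled_bessel 0 x - 1"
    unfolding R0 using R2(1) mult_left_mono[OF R1(1), of "2 * r"] r by linarith
  finally have lo: "- B \<le> scaled_bessel 0 x - 1" .
  have "B = 1 / (8 * x) + 9 / (32 * x\<^sup>2) * (1 + 11 / (4 * x) + 3 / (2 * x\<^sup>2))"
    by (simp add: B_def r_def power_divide)
  then show ?thesis using up lo by linarith
qed

lemma Psi_half: "Psi (1/2) z = exp (- 2 * z)"
  by (simp add: Psi_def power2_eq_square)

lemma G_fun_nonneg: "z > 0 \<Longrightarrow> \<nu> \<ge> 0 \<Longrightarrow> G_fun \<nu> z \<ge> 0"
  by (auto simp: G_fun_def intro!: mult_nonneg_nonneg add_nonneg_nonneg divide_nonneg_nonneg)

lemma one_le_powr_minus: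
  fixes t b :: real assumes "0 < t" "t \<le> 1" "b \<le> 0" shows "1 \<le> t powr b"
  using powr_mono2'[of b t 1] assms by simp

text \<open>The terms of \<open>\<Psi>\<close> with \<open>exp (- 2 * z)\<close> are nonnegative and can be dropped, and \<open>G_fun\<close> may be
  replaced by a smaller number.\<close>

lemma Psi_ge:
  assumes z: "z > 0" and \<nu>: "\<nu> \<ge> 0" and g: "0 \<le> g" "g \<le> G_fun \<nu> z"
  shows "\<bar>4 * \<nu>\<^sup>2 - 1\<bar> / (8 * z) + g * (\<bar>(4 * \<nu>\<^sup>2 - 1) * (4 * \<nu>\<^sup>2 - 9)\<bar> / (32 * z\<^sup>2)) \<le> Psi \<nu> z"
proof -
  define H where "H = (\<lambda>g. \<bar>4 * \<nu>\<^sup>2 - 1\<bar> / (8 * z)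
    + g * (\<bar>(4 * \<nu>\<^sup>2 - 1) * (4 * \<nu>\<^sup>2 - 9)\<bar> / (32 * z\<^sup>2)))"
  have "H g \<le> H (G_fun \<nu> z) * 1" unfolding mult_1_right H_def using g by (intro add_left_mono mult_right_mono) auto
  also have "H (G_fun \<nu> z) * 1 \<le> H (G_fun \<nu> z) * (1 + exp (- 2 * z))"
    using g z unfolding H_def by (intro mult_left_mono add_nonneg_nonneg mult_nonneg_nonneg) auto
  also have "\<dots> \<le> Psi \<nu> z" by (simp add: Psi_def H_def)
  finally show ?thesis by (simp add: H_def)
qed

text \<open>The error bound is stated for all \<open>z \<ge> z0\<close> with \<open>\<Psi>\<close> taken at \<open>z0\<close>, because \<open>z\<close> will be the
  variable argument under the integral and \<open>z0\<close> its value at the corner. The lower bounds on \<open>z0\<close>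
  are what makes the base of the power in \<open>G_fun\<close> positive, so that \<open>G_fun\<close> is at least \<open>1\<close> for
  \<open>\<nu> = 1\<close> and at least \<open>(1 + 3 / (4 * z0)) * (1 + 2 / z0)\<close> for \<open>\<nu> = 0\<close>.\<close>

lemma scaled_bessel_within_Psi:
  fixes N :: nat and z z0 :: real
  assumes N: "N \<ge> 3" and z0: "z0 > 0" and z: "z0 \<le> z"
    and large: "N > 4 \<Longrightarrow> real N / 4 - 1 < z0" and three: "N = 3 \<Longrightarrow> 3/4 < z0"
  shows "\<bar>scaled_bessel ((real N - 3) / 2) z - 1\<bar> \<le> Psi ((real N - 3) / 2) z0"
proof -
  have zp: "z > 0" using z0 z by simp
  define \<nu> where "\<nu> = (real N - 3) / 2"
  define a where "a = \<nu> + 1/2"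
  have \<nu>0: "\<nu> \<ge> 0" using N by (simp add: \<nu>_def)
  consider "N = 3" | "N = 4" | "N = 5" | "N \<ge> 6" using N by linarith
  then have "\<bar>scaled_bessel \<nu> z - 1\<bar> \<le> Psi \<nu> z0"
  proof cases
    case 1
    then have \<nu>: "\<nu> = 0" by (simp add: \<nu>_def)
    define q where "q = 1 - 3 / (4 * z0)"
    have q: "0 < q" "q < 1" using three[OF 1] z0 by (auto simp: q_def field_simps)
    have "1 + 3 / (4 * z0) \<le> 1 / q"
    proof -
      have "(1 + 3 / (4 * z0)) * q \<le> 1" by (simp add: q_def algebra_simps)
      then show ?thesis using q by (simp add: le_divide_eq)
    qed
    also have "\<dots> = q powr (-1)" using q by (simp add: powr_minus_divide)
    also have "\<dots> \<le> q powr (-3/2)" using q by (intro powr_mono') auto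
    finally have "(1 + 3 / (4 * z0)) * (1 + 2 / z0) \<le> q powr (-3/2) * (1 + 2 / z0)"
      using z0 by (intro mult_right_mono) auto
    also have "\<dots> = G_fun \<nu> z0" by (simp add: \<nu> G_fun_def q_def)
    finally have g: "(1 + 3 / (4 * z0)) * (1 + 2 / z0) \<le> G_fun \<nu> z0" .
    have "\<bar>scaled_bessel \<nu> z - 1\<bar> \<le> 1 / (8 * z) + 9 / (32 * z\<^sup>2) * (1 + 11 / (4 * z) + 3 / (2 * z\<^sup>2))"
      using scaled_bessel_0_bound[of z] three[OF 1] z by (simp add: \<nu>)
    also have "\<dots> \<le> 1 / (8 * z0) + 9 / (32 * z0\<^sup>2) * (1 + 11 / (4 * z0) + 3 / (2 * z0\<^sup>2))"
      using z z0 by (intro add_mono mult_mono divide_left_mono power_mono mult_left_mono add_nonneg_nonneg order.refl mult_pos_pos zero_less_power divide_nonneg_nonneg) auto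
    also have "\<dots> = \<bar>4 * \<nu>\<^sup>2 - 1\<bar> / (8 * z0) + (1 + 3 / (4 * z0)) * (1 + 2 / z0) * (\<bar>(4 * \<nu>\<^sup>2 - 1) * (4 * \<nu>\<^sup>2 - 9)\<bar> / (32 * z0\<^sup>2))"
      using z0 by (simp add: \<nu> divide_simps power2_eq_square) (simp add: algebra_simps)
    also have "\<dots> \<le> Psi \<nu> z0"
      using z0 \<nu>0 g by (intro Psi_ge) auto
    finally show ?thesis .
  next
    case 2
    then have \<nu>: "\<nu> = 1/2" by (simp add: \<nu>_def)
    show ?thesis unfolding \<nu> scaled_bessel_half[OF zp] Psi_half using z by simp
  next
    case 3
    then have \<nu>: "\<nu> = 1" by (simp add: \<nu>_def)
    have "1 \<le> G_fun \<nu> z0"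
      using large 3 by (simp add: \<nu> G_fun_def) (intro one_le_powr_minus; simp add: field_simps)
    then have "\<bar>4 * \<nu>\<^sup>2 - 1\<bar> / (8 * z0) + 1 * (\<bar>(4 * \<nu>\<^sup>2 - 1) * (4 * \<nu>\<^sup>2 - 9)\<bar> / (32 * z0\<^sup>2)) \<le> Psi \<nu> z0"
      using z0 \<nu>0 by (intro Psi_ge) auto
    moreover have "3 / (8 * z) + 15 / (32 * z\<^sup>2) \<le> 3 / (8 * z0) + 15 / (32 * z0\<^sup>2)"
      using z z0 by (intro add_mono divide_left_mono power_mono mult_left_mono mult_pos_pos zero_less_power) auto
    moreover have "scaled_bessel \<nu> z \<le> 1" using scaled_bessel_le_1[of "3/2" z] zp by (simp add: \<nu>)
    ultimately show ?thesis using scaled_bessel_1_ge[OF zp] by (simp add: \<nu>)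
  next
    case 4
    then have "(6::real) \<le> real N" by simp
    then have "6 / 2 \<le> real N / 2" by (intro divide_right_mono) auto
    then have a: "a \<ge> 2" unfolding a_def \<nu>_def diff_divide_distrib by simp
    have \<nu>: "\<nu> = a - 1/2" by (simp add: a_def)
    have c: "4 * \<nu>\<^sup>2 - 1 = 4 * ((a - 1) * a)" by (simp add: \<nu> power2_eq_square algebra_simps)
    have "(a - 1) * a / (2 * z) \<le> (a - 1) * a / (2 * z0)"
      using a z z0 by (intro divide_left_mono mult_nonneg_nonneg) auto
    also have "\<dots> = \<bar>4 * \<nu>\<^sup>2 - 1\<bar> / (8 * z0)" unfolding c using a by (simp add: abs_mult)
    also have "\<dots> \<le> Psi \<nu> z0" using Psi_ge[OF z0 \<nu>0, of 0] G_fun_nonneg[OF z0 \<nu>0] by simp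
    finally show ?thesis
      using scaled_bessel_le_1[of a z] scaled_bessel_ge_first_order[OF a zp] a zp by (simp add: \<nu>)
  qed
  then show ?thesis by (simp add: \<nu>_def)
qed

section \<open>The weighted Gaussian on a quadrant\<close>

lemma
  fixes s b :: real assumes s: "s > -1" and b: "b > 0"
  shows gaussian_moment_integrable: "integrable lborel (\<lambda>x. indicator {0<..} x * (x powr s * exp (- b * x\<^sup>2)))"
    and gaussian_moment: "(LBINT x. indicator {0<..} x * (x powr s * exp (- b * x\<^sup>2)))
        = Gamma ((s + 1) / 2) / (2 * b powr ((s + 1) / 2))"
proof -
  define r where "r = (s + 1) / 2"
  have r: "r > 0" using s by (simp add: r_def)
  let ?f = "\<lambda>u. exp (- u) * u powr (r - 1)"
  let ?g = "\<lambda>x::real. b * x\<^sup>2"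
  let ?h = "\<lambda>x. indicator {0<..} x * (x powr s * exp (- b * x\<^sup>2))"
  have img: "?g ` {0<..} = {0<..}"
  proof (intro equalityI subsetI)
    fix y :: real assume "y \<in> {0<..}"
    then show "y \<in> ?g ` {0<..}" using b by (intro image_eqI[of _ _ "sqrt (y / b)"]) auto
  qed (use b in auto)
  have inj: "inj_on ?g {0<..}" using b by (auto intro!: inj_onI simp: power2_eq_iff)
  have d: "(?g has_field_derivative 2 * b * x) (at x within {0<..})" for x :: real
    by (auto intro!: derivative_eq_intros)
  have [measurable]: "?f \<in> borel_measurable borel" "?g \<in> borel_measurable borel"
    "(\<lambda>x::real. 2 * b * x) \<in> borel_measurable borel" by measurable
  have cov: "set_integrable lborel {0<..} ?f
        \<longleftrightarrow> set_integrable lborel {0<..} (\<lambda>x. \<bar>2 * b * x\<bar> * ?f (?g x))"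
      "(LBINT u:{0<..}. ?f u) = (LBINT x:{0<..}. \<bar>2 * b * x\<bar> * ?f (?g x))"
    using set_lebesgue_integral_change_of_variables[of ?f ?g "\<lambda>x. 2 * b * x" "{0<..}",
      unfolded img, OF _ _ _ _ _ d inj] by measurable
  have eq: "indicator {0<..} x * (\<bar>2 * b * x\<bar> * ?f (?g x)) = 2 * b powr r * ?h x" for x
  proof (cases "x > 0")
    case True
    have "(b * x\<^sup>2) powr (r - 1) = b powr (r - 1) * x powr (2 * (r - 1))"
      using True b by (simp add: powr_mult powr_powr flip: powr_numeral)
    then have "b * x * (b * x\<^sup>2) powr (r - 1) = (b powr 1 * b powr (r - 1)) * (x powr 1 * x powr (2 * (r - 1)))"
      using True b by simp
    also have "\<dots> = b powr r * x powr s"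
    proof -
      have "1 + (r - 1) = r" "1 + 2 * (r - 1) = s" by (simp_all add: r_def field_simps)
      then show ?thesis unfolding powr_add[symmetric] by (simp only:)
    qed
    finally show ?thesis using True b by (simp add: mult_ac)
  qed simp
  have "set_integrable lborel {0<..} ?f"
    using Gamma_integrand_integrable[OF r] unfolding set_integrable_def real_scaleR_def .
  then have "integrable lborel (\<lambda>x. 2 * b powr r * ?h x)"
    using cov(1) unfolding set_integrable_def real_scaleR_def eq by simp
  then show "integrable lborel ?h" using b by simp
  have "2 * b powr r * integral\<^sup>L lborel ?h = Gamma r"
    using cov(2) Gamma_lebesgue_integral[OF r]
    unfolding set_lebesgue_integral_def real_scaleR_def eq by simp
  then show "integral\<^sup>L lborel ?h = Gamma ((s + 1) / 2) / (2 * b powr ((s + 1) / 2))"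
    using b by (simp add: r_def field_simps)
qed

lemma gaussian_moment_nn:
  fixes s b :: real assumes "s > -1" "b > 0"
  shows "(\<integral>\<^sup>+x. ennreal (indicator {0<..} x * (x powr s * exp (- b * x\<^sup>2))) \<partial>lborel)
        = ennreal (Gamma ((s + 1) / 2) / (2 * b powr ((s + 1) / 2)))"
  using nn_integral_eq_integral[OF gaussian_moment_integrable[OF assms]] gaussian_moment[OF assms] by simp

lemma powr_add_le_2_powr:
  fixes a b m :: real assumes "0 \<le> a" "0 \<le> b" "0 \<le> m"
  shows "(a + b) powr m \<le> 2 powr m * (a powr m + b powr m)"
proof -
  have "(a + b) powr m \<le> (2 * max a b) powr m" using assms by (intro powr_mono2) auto
  also have "\<dots> = 2 powr m * (max a b) powr m" using assms by (simp add: powr_mult)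
  also have "\<dots> \<le> 2 powr m * (a powr m + b powr m)" by (intro mult_left_mono) (auto simp: max_def)
  finally show ?thesis .
qed

text \<open>With \<open>w = y - h\<close>, the power \<open>(h + w) powr m\<close> is at most \<open>h powr m\<close> for \<open>w < 0\<close> and at most
  \<open>2 powr m * (h powr m + w powr m)\<close> for \<open>w > 0\<close>; both bounds are Gaussian moments over a half-line.\<close>

lemma shifted_gaussian_moment_le:
  fixes h m :: real assumes h: "h > 0" and m: "m \<ge> 0"
  shows "(\<integral>\<^sup>+y. ennreal (indicator {0<..} y * (y powr m * exp (- (y - h)\<^sup>2))) \<partial>lborel)
    \<le> ennreal ((2 * h) powr m * sqrt pi + 2 powr (m - 1) * Gamma ((m + 1) / 2))"
proof -
  define u where "u = (\<lambda>s w::real. indicator {0<..} w * (w powr s * exp (- 1 * w\<^sup>2)))"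
  have u0: "u s w \<ge> 0" for s w by (simp add: u_def)
  have [measurable]: "u s \<in> borel_measurable borel" for s unfolding u_def by measurable
  have nu: "(\<integral>\<^sup>+w. ennreal (u s w) \<partial>lborel) = ennreal (Gamma ((s + 1) / 2) / 2)" if "s > -1" for s
    using gaussian_moment_nn[OF that, of 1] unfolding u_def by simp
  have nu0: "(\<integral>\<^sup>+w. ennreal (u 0 w) \<partial>lborel) = ennreal (sqrt pi / 2)"
    using nu[of 0] by (simp add: Gamma_one_half_real)
  have nu0': "(\<integral>\<^sup>+w. ennreal (u 0 (- w)) \<partial>lborel) = ennreal (sqrt pi / 2)"
    using nn_integral_real_affine[of "\<lambda>w. ennreal (u 0 w)" "-1" 0] nu0 by simp
  let ?F = "\<lambda>y. ennreal (indicator {0<..} y * (y powr m * exp (- (y - h)\<^sup>2)))"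
  have "(\<integral>\<^sup>+y. ?F y \<partial>lborel) = (\<integral>\<^sup>+w. ?F (h + 1 * w) \<partial>lborel)"
    using nn_integral_real_affine[of ?F 1 h] by simp
  also have "\<dots> \<le> (\<integral>\<^sup>+w. ennreal (h powr m) * ennreal (u 0 (- w))
      + (ennreal (2 powr m * h powr m) * ennreal (u 0 w) + ennreal (2 powr m) * ennreal (u m w)) \<partial>lborel)"
  proof (rule nn_integral_mono_AE)
    have "AE w in lborel. w \<noteq> (0::real)" by (rule AE_lborel_singleton)
    then show "AE w in lborel. ?F (h + 1 * w) \<le> ennreal (h powr m) * ennreal (u 0 (- w))
      + (ennreal (2 powr m * h powr m) * ennreal (u 0 w) + ennreal (2 powr m) * ennreal (u m w))"
    proof eventually_elim
      case (elim w)
      have "indicator {0<..} (h + 1 * w) * ((h + 1 * w) powr m * exp (- (h + 1 * w - h)\<^sup>2))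
          \<le> h powr m * u 0 (- w) + (2 powr m * h powr m * u 0 w + 2 powr m * u m w)"
      proof (cases "w > 0")
        case True
        from mult_right_mono[OF powr_add_le_2_powr[of h w m], of "exp (- w\<^sup>2)"] True h m
        show ?thesis by (simp add: u_def algebra_simps)
      next
        case False
        with elim have w: "w < 0" by simp
        have "(h + w) powr m \<le> h powr m" if "h + w > 0" using that w m by (intro powr_mono2) auto
        then have "indicator {0<..} (h + w) * (h + w) powr m \<le> h powr m" by (auto simp: indicator_def)
        from mult_right_mono[OF this, of "exp (- w\<^sup>2)"] w show ?thesis by (simp add: u_def mult_ac)
      qed
      then show ?case using u0
        by (simp add: ennreal_leI flip: ennreal_mult' ennreal_plus)
    qed
  qed
  also have "\<dots> = ennreal (h powr m) * ennreal (sqrt pi / 2)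
     + (ennreal (2 powr m * h powr m) * ennreal (sqrt pi / 2) + ennreal (2 powr m) * ennreal (Gamma ((m + 1) / 2) / 2))"
    using m by (simp add: nn_integral_add nn_integral_cmult nu0 nu0' nu del: ennreal_mult)
  also have "\<dots> = ennreal (h powr m * (sqrt pi / 2) + (2 powr m * h powr m * (sqrt pi / 2) + 2 powr m * (Gamma ((m + 1) / 2) / 2)))"
    using m Gamma_real_pos[of "(m + 1) / 2"] by (simp add: less_imp_le flip: ennreal_mult' ennreal_plus)
  also have "\<dots> \<le> ennreal ((2 * h) powr m * sqrt pi + 2 powr (m - 1) * Gamma ((m + 1) / 2))"
  proof (rule ennreal_leI)
    have "2 powr 0 \<le> (2::real) powr m" using m by (intro powr_mono) auto
    then have e1: "1 * (h powr m * (sqrt pi / 2)) \<le> 2 powr m * (h powr m * (sqrt pi / 2))"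
      by (intro mult_right_mono) auto
    have e2: "(2 * h) powr m * sqrt pi = 2 * (2 powr m * (h powr m * (sqrt pi / 2)))"
      using h by (simp add: powr_mult)
    have e3: "2 powr (m - 1) = 2 powr m / (2::real)" by (simp add: powr_diff)
    show "h powr m * (sqrt pi / 2) + (2 powr m * h powr m * (sqrt pi / 2) + 2 powr m * (Gamma ((m + 1) / 2) / 2))
      \<le> (2 * h) powr m * sqrt pi + 2 powr (m - 1) * Gamma ((m + 1) / 2)"
      unfolding e2 e3 using e1 by (simp add: field_simps)
  qed
  finally show ?thesis .
qed

definition weight :: "real \<Rightarrow> real \<Rightarrow> real \<Rightarrow> real \<Rightarrow> real \<Rightarrow> real" where
  "weight k c m x y = exp (- k * (x\<^sup>2 - 2 * c * x * y + y\<^sup>2)) * (x * y) powr m"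

lemma weight_nonneg: "weight k c m x y \<ge> 0" by (simp add: weight_def)

lemma weight_measurable [measurable (raw)]:
  assumes [measurable]: "f \<in> borel_measurable M" "g \<in> borel_measurable M"
  shows "(\<lambda>x. weight k c m (f x) (g x)) \<in> borel_measurable M"
  unfolding weight_def by measurable

text \<open>Completing the square, \<open>x\<^sup>2 - 2 * c * x * y + y\<^sup>2 = (y - c * x)\<^sup>2 + (1 - c\<^sup>2) * x\<^sup>2\<close>, reduces the inner
  integral to \<open>shifted_gaussian_moment_le\<close> with \<open>h = c * x\<close>; the outer one is then a sum of two
  Gaussian moments.\<close>

lemma weight_quadrant_nn_le:
  fixes c m :: real assumes c: "0 < c" "c < 1" and m: "m \<ge> 0"
  shows "(\<integral>\<^sup>+x. \<integral>\<^sup>+y. ennreal (indicator {0<..} x * indicator {0<..} y * weight 1 c m x y) \<partial>lborel \<partial>lborel)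
    \<le> ennreal ((2 * c) powr m * sqrt pi * (Gamma (m + 1/2) / (2 * (1 - c\<^sup>2) powr (m + 1/2)))
        + 2 powr (m - 1) * ((Gamma ((m + 1) / 2))\<^sup>2 / (2 * (1 - c\<^sup>2) powr ((m + 1) / 2))))"
proof -
  define b where "b = 1 - c\<^sup>2"
  have b: "b > 0" using c by (simp add: b_def abs_square_less_1)
  define K where "K = 2 powr (m - 1) * Gamma ((m + 1) / 2)"
  have K: "K \<ge> 0" using m by (auto simp: K_def intro!: Gamma_real_pos mult_nonneg_nonneg less_imp_le)
  define u where "u = (\<lambda>s x::real. indicator {0<..} x * (x powr s * exp (- b * x\<^sup>2)))"
  have u0: "u s w \<ge> 0" for s w by (simp add: u_def)
  have [measurable]: "u s \<in> borel_measurable borel" for s unfolding u_def by measurable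
  have nu: "(\<integral>\<^sup>+w. ennreal (u s w) \<partial>lborel) = ennreal (Gamma ((s + 1) / 2) / (2 * b powr ((s + 1) / 2)))" if "s > -1" for s
    using gaussian_moment_nn[OF that b] unfolding u_def by simp
  have "(\<integral>\<^sup>+y. ennreal (indicator {0<..} x * indicator {0<..} y * weight 1 c m x y) \<partial>lborel)
     \<le> ennreal ((2 * c) powr m * sqrt pi) * ennreal (u (2 * m) x) + ennreal K * ennreal (u m x)" for x
  proof (cases "x > 0")
    case True
    have eq: "indicator {0<..} x * indicator {0<..} y * weight 1 c m x y
        = u m x * (indicator {0<..} y * (y powr m * exp (- (y - c * x)\<^sup>2)))" for y
    proof (cases "y > 0")
      case True': True
      have "- 1 * (x\<^sup>2 - 2 * c * x * y + y\<^sup>2) = - b * x\<^sup>2 + - (y - c * x)\<^sup>2"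
        by (simp add: b_def power2_eq_square algebra_simps)
      then show ?thesis using True True' unfolding weight_def u_def by (simp only: exp_add) (simp add: powr_mult)
    qed simp
    have "(\<integral>\<^sup>+y. ennreal (indicator {0<..} x * indicator {0<..} y * weight 1 c m x y) \<partial>lborel)
       = ennreal (u m x) * (\<integral>\<^sup>+y. ennreal (indicator {0<..} y * (y powr m * exp (- (y - c * x)\<^sup>2))) \<partial>lborel)"
      unfolding eq using u0 by (simp add: ennreal_mult nn_integral_cmult)
    also have "\<dots> \<le> ennreal (u m x) * ennreal ((2 * (c * x)) powr m * sqrt pi + K)"
      unfolding K_def using True c m by (intro mult_left_mono shifted_gaussian_moment_le) auto
    also have "\<dots> = ennreal (u m x * ((2 * (c * x)) powr m * sqrt pi + K))"
      using u0 by (simp add: ennreal_mult')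
    also have "u m x * ((2 * (c * x)) powr m * sqrt pi + K)
        = (2 * c) powr m * sqrt pi * u (2 * m) x + K * u m x"
    proof -
      have "(2 * (c * x)) powr m = (2 * c) powr m * x powr m" using True c powr_mult[of "2 * c" x m] by (simp add: mult_ac del: powr_mult)
      moreover have "x powr (2 * m) = x powr m * x powr m" using powr_add[of x m m] by simp
      ultimately show ?thesis using True by (simp add: u_def algebra_simps)
    qed
    finally show ?thesis using u0 K by (simp flip: ennreal_mult' ennreal_plus)
  qed simp
  then have "(\<integral>\<^sup>+x. \<integral>\<^sup>+y. ennreal (indicator {0<..} x * indicator {0<..} y * weight 1 c m x y) \<partial>lborel \<partial>lborel)
     \<le> (\<integral>\<^sup>+x. ennreal ((2 * c) powr m * sqrt pi) * ennreal (u (2 * m) x) + ennreal K * ennreal (u m x) \<partial>lborel)"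
    by (intro nn_integral_mono)
  also have "\<dots> = ennreal ((2 * c) powr m * sqrt pi) * ennreal (Gamma ((2 * m + 1) / 2) / (2 * b powr ((2 * m + 1) / 2)))
      + ennreal K * ennreal (Gamma ((m + 1) / 2) / (2 * b powr ((m + 1) / 2)))"
    using m by (simp add: nn_integral_add nn_integral_cmult nu del: ennreal_mult)
  also have "\<dots> = ennreal ((2 * c) powr m * sqrt pi * (Gamma ((2 * m + 1) / 2) / (2 * b powr ((2 * m + 1) / 2)))
      + K * (Gamma ((m + 1) / 2) / (2 * b powr ((m + 1) / 2))))"
    using m K by (simp add: less_imp_le Gamma_real_pos flip: ennreal_mult' ennreal_plus)
  also have "(2 * m + 1) / 2 = m + 1/2" by simp
  finally show ?thesis by (simp add: K_def b_def power2_eq_square mult.assoc)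
qed

lemma form_nonneg: "\<bar>c\<bar> \<le> 1 \<Longrightarrow> 0 \<le> x\<^sup>2 - 2 * c * x * y + (y::real)\<^sup>2"
proof -
  assume c: "\<bar>c\<bar> \<le> 1"
  have "x\<^sup>2 - 2 * c * x * y + y\<^sup>2 = (x - c * y)\<^sup>2 + (1 - c\<^sup>2) * y\<^sup>2"
    by (simp add: power2_eq_square algebra_simps)
  moreover have "c\<^sup>2 \<le> 1" using c by (simp add: abs_square_le_1)
  ultimately show ?thesis by simp
qed

lemma weight_antimono: "\<bar>c\<bar> \<le> 1 \<Longrightarrow> 1 \<le> k \<Longrightarrow> weight k c m x y \<le> weight 1 c m x y"
  unfolding weight_def using mult_right_mono[of 1 k "x\<^sup>2 - 2 * c * x * y + y\<^sup>2"] form_nonneg[of c x y]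
  by (intro mult_right_mono) auto

text \<open>The bound of \<open>weight_quadrant_nn_le\<close>. For \<open>m = N / 2 - 1\<close> it is, up to the factor
  \<open>1 / \<rho> powr (N / 2)\<close>, the bound on \<open>I6\<close>.\<close>

definition quadrant_bound :: "real \<Rightarrow> real \<Rightarrow> real" where
  "quadrant_bound c m = (2 * c) powr m * sqrt pi * (Gamma (m + 1/2) / (2 * (1 - c\<^sup>2) powr (m + 1/2)))
        + 2 powr (m - 1) * ((Gamma ((m + 1) / 2))\<^sup>2 / (2 * (1 - c\<^sup>2) powr ((m + 1) / 2)))"

lemma quadrant_bound_nonneg: "m \<ge> 0 \<Longrightarrow> quadrant_bound c m \<ge> 0"
  unfolding quadrant_bound_def
  by (intro add_nonneg_nonneg mult_nonneg_nonneg divide_nonneg_nonneg) (auto intro!: less_imp_le)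

abbreviation on_rect :: "real set \<Rightarrow> real set \<Rightarrow> (real \<Rightarrow> real \<Rightarrow> real) \<Rightarrow> real \<times> real \<Rightarrow> real" where
  "on_rect A B f \<equiv> (\<lambda>(x, y). indicator A x * indicator B y * f x y)"

abbreviation plane :: "(real \<times> real) measure" where "plane \<equiv> lborel \<Otimes>\<^sub>M lborel"

lemma
  fixes c k m :: real assumes c: "0 < c" "c < 1" and m: "m \<ge> 0" and k: "k \<ge> 1"
  shows weight_integrable_quadrant: "integrable plane (on_rect {0<..} {0<..} (weight k c m))"
    and weight_quadrant_integral_le: "integral\<^sup>L plane (on_rect {0<..} {0<..} (weight 1 c m)) \<le> quadrant_bound c m"
proof -
  have meas [measurable]: "on_rect {0<..} {0<..} (weight j c m) \<in> borel_measurable plane" for j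
    by measurable
  let ?n = "\<lambda>j. \<integral>\<^sup>+z. ennreal (on_rect {0<..} {0<..} (weight j c m) z) \<partial>plane"
  have "?n 1 = (\<integral>\<^sup>+x. \<integral>\<^sup>+y. ennreal (on_rect {0<..} {0<..} (weight 1 c m) (x, y)) \<partial>lborel \<partial>lborel)"
    by (intro lborel.nn_integral_fst[symmetric] measurable_compose[OF meas] measurable_ennreal)
  then have b1: "?n 1 \<le> ennreal (quadrant_bound c m)"
    using weight_quadrant_nn_le[OF c m] unfolding quadrant_bound_def prod.case by (simp only:)
  have "?n k \<le> ?n 1"
    using weight_antimono[of c k m] c k
    by (intro nn_integral_mono) (auto intro!: ennreal_leI mult_left_mono)
  also note b1
  also have "ennreal (quadrant_bound c m) < \<infinity>" by simp
  finally have "?n k < \<infinity>" .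
  then show "integrable plane (on_rect {0<..} {0<..} (weight k c m))"
    by (intro integrableI_nonneg) (auto simp: weight_nonneg)
  have "quadrant_bound c m \<ge> 0" by (rule quadrant_bound_nonneg[OF m])
  then show "integral\<^sup>L plane (on_rect {0<..} {0<..} (weight 1 c m)) \<le> quadrant_bound c m"
    using b1 by (subst integral_eq_nn_integral) (auto simp: weight_nonneg intro!: enn2real_leI)
qed

lemma integrable_on_subrect:
  assumes "integrable plane (on_rect A B f)" "A' \<subseteq> A" "B' \<subseteq> B" "A' \<in> sets borel" "B' \<in> sets borel"
  shows "integrable plane (on_rect A' B' f)"
proof -
  have "integrable plane (\<lambda>z. indicator (A' \<times> B') z *\<^sub>R on_rect A B f z)"
    using assms by (intro integrable_mult_indicator) auto
  also have "(\<lambda>z. indicator (A' \<times> B') z *\<^sub>R on_rect A B f z) = on_rect A' B' f"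
    using assms(2,3) by (auto simp: fun_eq_iff indicator_def)
  finally show ?thesis .
qed

lemma iterated_eq_plane_integral:
  assumes "integrable plane (on_rect A B f)"
  shows "(LBINT x:A. (LBINT y:B. f x y)) = integral\<^sup>L plane (on_rect A B f)"
proof -
  have "integral\<^sup>L plane (on_rect A B f) = (LBINT x. (LBINT y. on_rect A B f (x, y)))"
    using lborel_pair.integral_fst'[OF assms] by simp
  also have "\<dots> = (LBINT x:A. (LBINT y:B. f x y))"
    by (simp add: set_lebesgue_integral_def mult.assoc)
  finally show ?thesis by simp
qed

text \<open>The function \<open>2 * k * (y - h) * exp (- k * (y\<^sup>2 - 2 * h * y))\<close> has an elementary antiderivative, and
  on the segment its first factor lies between the values at the two ends.\<close>

lemma
  fixes a h k e :: real assumes h: "h < a" and k: "k > 0" and e: "e \<ge> 0"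
  defines "S \<equiv> (LBINT y:{a..a + e}. exp (- k * (y\<^sup>2 - 2 * h * y)))"
    and "T \<equiv> exp (- k * (a\<^sup>2 - 2 * h * a)) * (1 - exp (- k * e * (2 * (a - h) + e)))"
  shows gaussian_segment_integrable: "set_integrable lborel {a..a + e} (\<lambda>y. exp (- k * (y\<^sup>2 - 2 * h * y)))"
    and gaussian_segment_le: "S \<le> T / (2 * k * (a - h))"
    and gaussian_segment_ge: "T / (2 * k * (a + e - h)) \<le> S"
proof -
  let ?f = "\<lambda>y. exp (- k * (y\<^sup>2 - 2 * h * y))"
  show int: "set_integrable lborel {a..a + e} ?f"
    by (intro borel_integrable_atLeastAtMost') (auto intro!: continuous_intros)
  have int': "set_integrable lborel {a..a + e} (\<lambda>y. 2 * k * (y - h) * ?f y)"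
    by (intro borel_integrable_atLeastAtMost') (auto intro!: continuous_intros)
  have "(LBINT y:{a..a + e}. 2 * k * (y - h) * ?f y) = - ?f (a + e) - (- ?f a)"
    unfolding set_lebesgue_integral_def using e
    by (intro integral_FTC_Icc)
      (auto intro!: derivative_eq_intros continuous_intros simp: has_real_derivative_iff_has_vector_derivative[symmetric] algebra_simps)
  also have "\<dots> = T"
  proof -
    have "- k * ((a + e)\<^sup>2 - 2 * h * (a + e)) = - k * (a\<^sup>2 - 2 * h * a) + - k * e * (2 * (a - h) + e)"
      by (simp add: power2_eq_square algebra_simps)
    then show ?thesis by (simp only: exp_add T_def) (simp add: algebra_simps)
  qed
  finally have T: "(LBINT y:{a..a + e}. 2 * k * (y - h) * ?f y) = T" .
  have "(LBINT y:{a..a + e}. 2 * k * (a - h) * ?f y) \<le> T"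
    unfolding T[symmetric] using h k
    by (intro set_integral_mono int' set_integrable_mult_right int mult_right_mono mult_left_mono) auto
  then show "S \<le> T / (2 * k * (a - h))"
    using h k by (simp add: S_def le_divide_eq mult.commute)
  have "T \<le> (LBINT y:{a..a + e}. 2 * k * (a + e - h) * ?f y)"
    unfolding T[symmetric] using h k
    by (intro set_integral_mono int' set_integrable_mult_right int mult_right_mono mult_left_mono) auto
  then show "T / (2 * k * (a + e - h)) \<le> S"
    using h k e by (simp add: S_def divide_le_eq mult.commute)
qed

section \<open>Splitting the integral at the corner of the quadrant\<close>

text \<open>Integrate over \<open>y\<close> with \<open>h = c * x\<close> and then over \<open>x\<close> with \<open>h = c * \<rho>\<close>. After the first step the
  dependence on \<open>x\<close> sits in \<open>v x\<close>, which is again of the form treated by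
  \<open>gaussian_segment_le\<close>, and in the factors \<open>\<rho> - c * x\<close> and \<open>\<rho> + e - c * x\<close>, which are
  replaced by their extreme values for \<open>x\<close> in \<open>{1..1 + e}\<close>. Exponent \<open>m = 0\<close> in the weight gives the
  pure Gaussian.\<close>

lemma
  fixes c \<rho> k e :: real
  assumes c: "0 < c" "c < 1" and k: "k \<ge> 1" and e: "e > 0"
    and \<rho>: "c < \<rho>" "c * \<rho> < 1" and ce: "c * e < \<rho> - c"
  defines "D \<equiv> integral\<^sup>L plane (on_rect {1..1 + e} {\<rho>..\<rho> + e} (weight k c 0))"
    and "q0 \<equiv> \<rho>\<^sup>2 - 2 * c * \<rho> + 1"
    and "t4 \<equiv> exp (- k * e * (2 * (\<rho> - c - c * e) + e))"
    and "t7 \<equiv> exp (- k * e * (2 * (1 - c * \<rho>) + e))"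
  shows box_gaussian_le: "exp (k * q0) * D \<le> (1 - t7) / (4 * k\<^sup>2 * (\<rho> - c - c * e) * (1 - c * \<rho>))"
    and box_gaussian_ge: "(1 - t4) * (1 - t7) / (4 * k\<^sup>2 * (\<rho> - c + e) * (1 - c * \<rho> + e)) \<le> exp (k * q0) * D"
proof -
  have prod_div: "P / (2 * k * a) * (Q / (2 * k * b)) = Q * P / (4 * k\<^sup>2 * b * a)" for P Q a b :: real
    by (simp add: power2_eq_square mult_ac)
  have kp: "k > 0" using k by simp
  have int: "integrable plane (on_rect {1..1 + e} {\<rho>..\<rho> + e} (weight k c 0))"
    by (rule integrable_on_subrect[OF weight_integrable_quadrant[OF c order.refl k]]) (use c \<rho> in auto)
  define s where "s = (\<lambda>x. LBINT y:{\<rho>..\<rho> + e}. exp (- k * (y\<^sup>2 - 2 * (c * x) * y)))"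
  define v where "v = (\<lambda>x. exp (- k * (x\<^sup>2 - 2 * (c * \<rho>) * x)))"
  have inner: "(LBINT y:{\<rho>..\<rho> + e}. weight k c 0 x y) = exp (- k * x\<^sup>2) * s x" if "x > 0" for x
  proof -
    have "(LBINT y:{\<rho>..\<rho> + e}. weight k c 0 x y)
        = (LBINT y:{\<rho>..\<rho> + e}. exp (- k * x\<^sup>2) * exp (- k * (y\<^sup>2 - 2 * (c * x) * y)))"
    proof (rule set_lebesgue_integral_cong)
      show "\<forall>y. y \<in> {\<rho>..\<rho> + e} \<longrightarrow> weight k c 0 x y = exp (- k * x\<^sup>2) * exp (- k * (y\<^sup>2 - 2 * (c * x) * y))"
      proof (intro allI impI)
        fix y assume "y \<in> {\<rho>..\<rho> + e}"
        then have "x * y \<noteq> 0" using that c \<rho> by auto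
        moreover have "- k * (x\<^sup>2 - 2 * c * x * y + y\<^sup>2) = - k * x\<^sup>2 + - k * (y\<^sup>2 - 2 * (c * x) * y)"
          by (simp add: algebra_simps)
        ultimately show "weight k c 0 x y = exp (- k * x\<^sup>2) * exp (- k * (y\<^sup>2 - 2 * (c * x) * y))"
          unfolding weight_def exp_add[symmetric] by simp
      qed
    qed simp
    also have "\<dots> = exp (- k * x\<^sup>2) * s x" unfolding s_def by (rule set_integral_mult_right)
    finally show ?thesis .
  qed
  have Dfub: "D = (LBINT x:{1..1 + e}. exp (- k * x\<^sup>2) * s x)"
  proof -
    have "D = (LBINT x:{1..1 + e}. (LBINT y:{\<rho>..\<rho> + e}. weight k c 0 x y))"
      unfolding D_def by (rule iterated_eq_plane_integral[OF int, symmetric])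
    also have "\<dots> = (LBINT x:{1..1 + e}. exp (- k * x\<^sup>2) * s x)"
      by (rule set_lebesgue_integral_cong) (auto simp: inner)
    finally show ?thesis .
  qed
  have outer_int: "set_integrable lborel {1..1 + e} (\<lambda>x. exp (- k * x\<^sup>2) * s x)"
  proof -
    have "integrable lborel (\<lambda>x. LBINT y. on_rect {1..1 + e} {\<rho>..\<rho> + e} (weight k c 0) (x, y))"
      by (rule lborel_pair.integrable_fst'[OF int])
    also have "(\<lambda>x. LBINT y. on_rect {1..1 + e} {\<rho>..\<rho> + e} (weight k c 0) (x, y))
        = (\<lambda>x. indicator {1..1 + e} x *\<^sub>R (exp (- k * x\<^sup>2) * s x))"
    proof
      fix x :: real
      have "(LBINT y. on_rect {1..1 + e} {\<rho>..\<rho> + e} (weight k c 0) (x, y))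
          = indicator {1..1 + e} x * (LBINT y:{\<rho>..\<rho> + e}. weight k c 0 x y)"
        by (simp add: set_lebesgue_integral_def mult.assoc)
      then show "(LBINT y. on_rect {1..1 + e} {\<rho>..\<rho> + e} (weight k c 0) (x, y))
          = indicator {1..1 + e} x *\<^sub>R (exp (- k * x\<^sup>2) * s x)"
        using inner[of x] by (cases "x \<in> {1..1 + e}") auto
    qed
    finally show ?thesis unfolding set_integrable_def .
  qed
  have vx: "exp (- k * x\<^sup>2) * exp (- k * (\<rho>\<^sup>2 - 2 * (c * x) * \<rho>)) = exp (- k * \<rho>\<^sup>2) * v x" for x
    unfolding v_def exp_add[symmetric] by (simp add: algebra_simps)
  have vxC: "(exp (- k * \<rho>\<^sup>2) * C) * v x = exp (- k * x\<^sup>2) * (exp (- k * (\<rho>\<^sup>2 - 2 * (c * x) * \<rho>)) * C)" for x C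
    using arg_cong[OF vx[of x], of "\<lambda>t. t * C"] by (simp only: mult_ac)
  have vint: "set_integrable lborel {1..1 + e} v"
    unfolding v_def using gaussian_segment_integrable[of "c * \<rho>" 1 k e] \<rho> kp e by simp
  have r: "\<rho> - c > 0" "1 - c * \<rho> > 0" using \<rho> by auto
  have s_le: "s x \<le> exp (- k * (\<rho>\<^sup>2 - 2 * (c * x) * \<rho>)) * (1 / (2 * k * (\<rho> - c - c * e)))"
    and s_ge: "exp (- k * (\<rho>\<^sup>2 - 2 * (c * x) * \<rho>)) * ((1 - t4) / (2 * k * (\<rho> - c + e))) \<le> s x"
    if x: "x \<in> {1..1 + e}" for x
  proof -
    have cx: "c \<le> c * x" "c * x \<le> c + c * e" using x c by (auto simp flip: distrib_left mult_1_right)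
       (use mult_left_mono[of x "1 + e" c] in \<open>auto simp: algebra_simps\<close>)
    then have h: "c * x < \<rho>" using ce by linarith
    define tx where "tx = exp (- k * e * (2 * (\<rho> - c * x) + e))"
    have tx: "0 \<le> 1 - tx" "1 - tx \<le> 1" using h kp e by (auto simp: tx_def intro!: mult_nonneg_nonneg)
    have "- k * e * (2 * (\<rho> - c * x) + e) \<le> - k * e * (2 * (\<rho> - c - c * e) + e)"
      using cx kp e mult_left_mono[of "2 * (\<rho> - c - c * e) + e" "2 * (\<rho> - c * x) + e" "k * e"] by simp
    \<comment> \<open>at \<open>x = 1 + e\<close> the factor \<open>1 - tx\<close> is smallest\<close>
    then have tx4: "1 - t4 \<le> 1 - tx" unfolding tx_def t4_def by simp
    have "s x \<le> exp (- k * (\<rho>\<^sup>2 - 2 * (c * x) * \<rho>)) * (1 - tx) / (2 * k * (\<rho> - c * x))"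
      unfolding s_def tx_def using gaussian_segment_le[OF h kp, of e] e by simp
    also have "\<dots> \<le> exp (- k * (\<rho>\<^sup>2 - 2 * (c * x) * \<rho>)) * 1 / (2 * k * (\<rho> - c - c * e))"
      using tx cx ce kp h by (intro frac_le mult_left_mono) auto
    finally show "s x \<le> exp (- k * (\<rho>\<^sup>2 - 2 * (c * x) * \<rho>)) * (1 / (2 * k * (\<rho> - c - c * e)))" by simp
    have "exp (- k * (\<rho>\<^sup>2 - 2 * (c * x) * \<rho>)) * (1 - t4) / (2 * k * (\<rho> - c + e))
        \<le> exp (- k * (\<rho>\<^sup>2 - 2 * (c * x) * \<rho>)) * (1 - tx) / (2 * k * (\<rho> + e - c * x))"
      using tx tx4 cx ce kp h e r by (intro frac_le mult_left_mono mult_nonneg_nonneg) auto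
    also have "\<dots> \<le> s x"
      unfolding s_def tx_def using gaussian_segment_ge[OF h kp, of e] e by simp
    finally show "exp (- k * (\<rho>\<^sup>2 - 2 * (c * x) * \<rho>)) * ((1 - t4) / (2 * k * (\<rho> - c + e))) \<le> s x" by simp
  qed
  define V where "V = (LBINT x:{1..1 + e}. v x)"
  have e7: "exp (k * q0) * exp (- k * \<rho>\<^sup>2) * (exp (- k * (1\<^sup>2 - 2 * (c * \<rho>) * 1)) * (1 - t7)) = 1 - t7"
    unfolding mult.assoc[symmetric] exp_add[symmetric] by (simp add: q0_def algebra_simps)
  have V_le: "exp (k * q0) * exp (- k * \<rho>\<^sup>2) * V \<le> (1 - t7) / (2 * k * (1 - c * \<rho>))"
  proof -
    have "V \<le> exp (- k * (1\<^sup>2 - 2 * (c * \<rho>) * 1)) * (1 - t7) / (2 * k * (1 - c * \<rho>))"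
      unfolding V_def v_def t7_def using gaussian_segment_le[of "c * \<rho>" 1 k e] \<rho> kp e by simp
    from mult_left_mono[OF this, of "exp (k * q0) * exp (- k * \<rho>\<^sup>2)"]
    show ?thesis unfolding times_divide_eq_right e7 by simp
  qed
  have V_ge: "(1 - t7) / (2 * k * (1 - c * \<rho> + e)) \<le> exp (k * q0) * exp (- k * \<rho>\<^sup>2) * V"
  proof -
    have "exp (- k * (1\<^sup>2 - 2 * (c * \<rho>) * 1)) * (1 - t7) / (2 * k * (1 - c * \<rho> + e)) \<le> V"
      unfolding V_def v_def t7_def using gaussian_segment_ge[of "c * \<rho>" 1 k e] \<rho> kp e
      by (simp add: algebra_simps)
    from mult_left_mono[OF this, of "exp (k * q0) * exp (- k * \<rho>\<^sup>2)"]
    show ?thesis unfolding times_divide_eq_right e7 by simp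
  qed
  have "D \<le> (LBINT x:{1..1 + e}. (exp (- k * \<rho>\<^sup>2) * (1 / (2 * k * (\<rho> - c - c * e)))) * v x)"
    unfolding Dfub
  proof (intro set_integral_mono outer_int set_integrable_mult_right vint)
    fix x assume "x \<in> {1..1 + e}"
    then show "exp (- k * x\<^sup>2) * s x \<le> (exp (- k * \<rho>\<^sup>2) * (1 / (2 * k * (\<rho> - c - c * e)))) * v x"
      unfolding vxC by (intro mult_left_mono s_le s_ge) auto
  qed
  also have "\<dots> = (exp (- k * \<rho>\<^sup>2) * (1 / (2 * k * (\<rho> - c - c * e)))) * V"
    unfolding V_def by (rule set_integral_mult_right)
  finally have "exp (k * q0) * D \<le> exp (k * q0) * ((exp (- k * \<rho>\<^sup>2) * (1 / (2 * k * (\<rho> - c - c * e)))) * V)"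
    by (intro mult_left_mono) auto
  also have "\<dots> = (exp (k * q0) * exp (- k * \<rho>\<^sup>2) * V) * (1 / (2 * k * (\<rho> - c - c * e)))" by (simp add: mult_ac)
  also have "\<dots> \<le> (1 - t7) / (2 * k * (1 - c * \<rho>)) * (1 / (2 * k * (\<rho> - c - c * e)))"
    using kp ce by (intro mult_right_mono V_le) auto
  also have "\<dots> = (1 - t7) / (4 * k\<^sup>2 * (\<rho> - c - c * e) * (1 - c * \<rho>))"
    unfolding prod_div by simp
  finally show "exp (k * q0) * D \<le> (1 - t7) / (4 * k\<^sup>2 * (\<rho> - c - c * e) * (1 - c * \<rho>))" .
  have t4: "1 - t4 \<ge> 0" using kp e ce by (auto simp: t4_def intro!: mult_nonneg_nonneg)
  have "(1 - t4) * (1 - t7) / (4 * k\<^sup>2 * (\<rho> - c + e) * (1 - c * \<rho> + e))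
      = (1 - t7) / (2 * k * (1 - c * \<rho> + e)) * ((1 - t4) / (2 * k * (\<rho> - c + e)))"
    unfolding prod_div by simp
  also have "\<dots> \<le> (exp (k * q0) * exp (- k * \<rho>\<^sup>2) * V) * ((1 - t4) / (2 * k * (\<rho> - c + e)))"
    using kp r e t4 by (intro mult_right_mono V_ge) auto
  also have "\<dots> = exp (k * q0) * ((exp (- k * \<rho>\<^sup>2) * ((1 - t4) / (2 * k * (\<rho> - c + e)))) * V)" by (simp add: mult_ac)
  also have "\<dots> \<le> exp (k * q0) * D"
  proof (intro mult_left_mono)
    have "(exp (- k * \<rho>\<^sup>2) * ((1 - t4) / (2 * k * (\<rho> - c + e)))) * V
       = (LBINT x:{1..1 + e}. (exp (- k * \<rho>\<^sup>2) * ((1 - t4) / (2 * k * (\<rho> - c + e)))) * v x)"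
      unfolding V_def by (rule set_integral_mult_right[symmetric])
    also have "\<dots> \<le> D" unfolding Dfub
    proof (intro set_integral_mono outer_int set_integrable_mult_right vint)
      fix x assume "x \<in> {1..1 + e}"
      then show "(exp (- k * \<rho>\<^sup>2) * ((1 - t4) / (2 * k * (\<rho> - c + e)))) * v x \<le> exp (- k * x\<^sup>2) * s x"
        unfolding vxC by (intro mult_left_mono s_le s_ge) auto
    qed
    finally show "(exp (- k * \<rho>\<^sup>2) * ((1 - t4) / (2 * k * (\<rho> - c + e)))) * V \<le> D" .
  qed simp
  finally show "(1 - t4) * (1 - t7) / (4 * k\<^sup>2 * (\<rho> - c + e) * (1 - c * \<rho> + e)) \<le> exp (k * q0) * D" .
qed

text \<open>On a ray from the corner, \<open>t = u * s\<close> with fixed \<open>u\<close> in \<open>{0..1}\<close>, the form is increasing in \<open>s\<close>,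
  so it suffices to bound it at \<open>s = e\<close>, where \<open>c * e \<le> B\<close> makes the terms with \<open>u\<close> nonnegative.\<close>

lemma shifted_form_ge:
  fixes A B c e s t :: real
  assumes A: "A \<ge> 0" and B: "c * e \<le> B" and c: "0 \<le> c" "c < 1" and e: "0 < e" "e \<le> s" and t: "0 \<le> t" "t \<le> s"
  shows "e * (2 * A + e) \<le> 2 * A * s + 2 * B * t + s\<^sup>2 - 2 * c * s * t + t\<^sup>2"
proof -
  define u where "u = t / s"
  have u: "0 \<le> u" "u \<le> 1" "t = u * s" using e t by (auto simp: u_def)
  have "0 \<le> c * e" using c e by simp
  then have B0: "0 \<le> B" using B by linarith
  have "0 \<le> u * e * (2 * (B - c * e) + u * e)" using u e B by (intro mult_nonneg_nonneg add_nonneg_nonneg) auto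
  then have "e * (2 * A + e) \<le> e * (2 * A + 2 * B * u) + e\<^sup>2 * (1\<^sup>2 - 2 * c * 1 * u + u\<^sup>2)"
    by (simp add: power2_eq_square algebra_simps)
  also have "\<dots> \<le> s * (2 * A + 2 * B * u) + s\<^sup>2 * (1\<^sup>2 - 2 * c * 1 * u + u\<^sup>2)"
    using e u A B0 c by (intro add_mono mult_right_mono form_nonneg power_mono add_nonneg_nonneg mult_nonneg_nonneg) auto
  also have "\<dots> = 2 * A * s + 2 * B * t + s\<^sup>2 - 2 * c * s * t + t\<^sup>2"
    unfolding u(3) by (simp add: power2_eq_square algebra_simps)
  finally show ?thesis .
qed

text \<open>In coordinates \<open>s = x - 1\<close>, \<open>t = y - \<rho>\<close> the gradient of the form at the corner is
  \<open>(2 * (1 - c * \<rho>), 2 * (\<rho> - c))\<close>. Outside the box the larger of \<open>s\<close> and \<open>t\<close> exceeds \<open>e\<close>, and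
  \<open>shifted_form_ge\<close> applies with that one in the first place.\<close>

lemma form_ge_outside_box:
  fixes c \<rho> e x y :: real
  assumes c: "0 < c" "c < 1" and e: "e > 0" and ce: "c * e \<le> \<rho> - c" "c * e \<le> 1 - c * \<rho>"
    and x: "1 \<le> x" and y: "\<rho> \<le> y" and out: "1 + e < x \<or> \<rho> + e < y"
  shows "\<rho>\<^sup>2 - 2 * c * \<rho> + 1 + e * (2 * min (\<rho> - c) (1 - c * \<rho>) + e) \<le> x\<^sup>2 - 2 * c * x * y + y\<^sup>2"
proof -
  define s where "s = x - 1"
  define t where "t = y - \<rho>"
  have ce0: "0 < c * e" using c e by simp
  have cr: "c * \<rho> \<le> 1" "c \<le> \<rho>" using ce ce0 by linarith+
  have exy: "x\<^sup>2 - 2 * c * x * y + y\<^sup>2 = \<rho>\<^sup>2 - 2 * c * \<rho> + 1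
      + (2 * (1 - c * \<rho>) * s + 2 * (\<rho> - c) * t + s\<^sup>2 - 2 * c * s * t + t\<^sup>2)"
    by (simp add: s_def t_def power2_eq_square algebra_simps)
  have "e * (2 * min (\<rho> - c) (1 - c * \<rho>) + e)
      \<le> 2 * (1 - c * \<rho>) * s + 2 * (\<rho> - c) * t + s\<^sup>2 - 2 * c * s * t + t\<^sup>2"
  proof (cases "t \<le> s")
    case True
    have "e * (2 * min (\<rho> - c) (1 - c * \<rho>) + e) \<le> e * (2 * (1 - c * \<rho>) + e)"
      using e by (intro mult_left_mono add_right_mono min.cobounded2) auto
    also have "\<dots> \<le> 2 * (1 - c * \<rho>) * s + 2 * (\<rho> - c) * t + s\<^sup>2 - 2 * c * s * t + t\<^sup>2"
      using assms True ce0 cr by (intro shifted_form_ge) (auto simp: s_def t_def)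
    finally show ?thesis .
  next
    case False
    have "e * (2 * min (\<rho> - c) (1 - c * \<rho>) + e) \<le> e * (2 * (\<rho> - c) + e)"
      using e by (intro mult_left_mono add_right_mono min.cobounded1) auto
    also have "\<dots> \<le> 2 * (\<rho> - c) * t + 2 * (1 - c * \<rho>) * s + t\<^sup>2 - 2 * c * t * s + s\<^sup>2"
      using assms False ce0 cr by (intro shifted_form_ge) (auto simp: s_def t_def)
    finally show ?thesis by (simp add: mult_ac)
  qed
  then show ?thesis unfolding exy by simp
qed

text \<open>Only the part \<open>k - 1\<close> of the exponent is estimated by the gap, so that an integrable weight
  remains.\<close>

lemma weight_le_outside_box:
  fixes c \<rho> e x y :: real
  assumes "0 < c" "c < 1" "e > 0" "c * e \<le> \<rho> - c" "c * e \<le> 1 - c * \<rho>"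
    "1 \<le> x" "\<rho> \<le> y" "1 + e < x \<or> \<rho> + e < y" and k: "k \<ge> 1"
  shows "weight k c m x y \<le> exp (- (k - 1) * (\<rho>\<^sup>2 - 2 * c * \<rho> + 1 + e * (2 * min (\<rho> - c) (1 - c * \<rho>) + e))) * weight 1 c m x y"
proof -
  let ?Q = "x\<^sup>2 - 2 * c * x * y + y\<^sup>2"
  let ?L = "\<rho>\<^sup>2 - 2 * c * \<rho> + 1 + e * (2 * min (\<rho> - c) (1 - c * \<rho>) + e)"
  have "?L \<le> ?Q" using assms by (intro form_ge_outside_box) auto
  then have "(k - 1) * ?L \<le> (k - 1) * ?Q" using k by (intro mult_left_mono) auto
  then have "exp (- k * ?Q) \<le> exp (- (k - 1) * ?L) * exp (- 1 * ?Q)"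
    unfolding exp_add[symmetric] by (simp add: algebra_simps)
  from mult_right_mono[OF this, of "(x * y) powr m"] show ?thesis
    by (simp add: weight_def mult.assoc)
qed

text \<open>On the box \<open>x * y\<close> lies between \<open>\<rho>\<close> and \<open>(1 + e) * (\<rho> + e)\<close>, which compares the weight with the
  pure Gaussian. Outside the box \<open>weight_le_outside_box\<close> compares it with the weight for \<open>k = 1\<close>,
  whose integral is bounded by that over the whole positive quadrant.\<close>

lemma
  fixes c \<rho> k m e :: real
  assumes c: "0 < c" "c < 1" and k: "k \<ge> 1" and m: "m \<ge> 0" and e: "e > 0"
    and \<rho>: "c < \<rho>" "c * \<rho> < 1" and ce: "c * e < \<rho> - c" "c * e < 1 - c * \<rho>"
  defines "J \<equiv> integral\<^sup>L plane (on_rect {1..} {\<rho>..} (weight k c m))"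
    and "J_box \<equiv> integral\<^sup>L plane (on_rect {1..1 + e} {\<rho>..\<rho> + e} (weight k c m))"
    and "D \<equiv> integral\<^sup>L plane (on_rect {1..1 + e} {\<rho>..\<rho> + e} (weight k c 0))"
    and "L \<equiv> \<rho>\<^sup>2 - 2 * c * \<rho> + 1 + e * (2 * min (\<rho> - c) (1 - c * \<rho>) + e)"
  shows box_integral_le_corner: "J_box \<le> J"
    and corner_minus_box_le: "J - J_box \<le> exp (- (k - 1) * L) * quadrant_bound c m"
    and box_integral_ge: "\<rho> powr m * D \<le> J_box"
    and box_integral_le: "J_box \<le> ((1 + e) * (\<rho> + e)) powr m * D"
proof -
  have \<rho>0: "\<rho> > 0" using c \<rho> by simp
  have corner: "integrable plane (on_rect {1..} {\<rho>..} (weight j c n))" if "j \<ge> 1" "n \<ge> 0" for j n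
    by (rule integrable_on_subrect[OF weight_integrable_quadrant[OF c that(2,1)]]) (use \<rho>0 in auto)
  have box: "integrable plane (on_rect {1..1 + e} {\<rho>..\<rho> + e} (weight j c n))" if "j \<ge> 1" "n \<ge> 0" for j n
    by (rule integrable_on_subrect[OF weight_integrable_quadrant[OF c that(2,1)]]) (use \<rho>0 in auto)
  let ?out = "\<lambda>z. on_rect {1..} {\<rho>..} (weight k c m) z - on_rect {1..1 + e} {\<rho>..\<rho> + e} (weight k c m) z"
  have out_int: "integrable plane ?out" using k m by (intro Bochner_Integration.integrable_diff corner box)
  have diff: "J - J_box = integral\<^sup>L plane ?out"
    unfolding J_def J_box_def using k m by (intro Bochner_Integration.integral_diff[symmetric] corner box)
  have "0 \<le> integral\<^sup>L plane ?out"
    by (intro Bochner_Integration.integral_nonneg) (auto simp: indicator_def weight_nonneg)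
  then show "J_box \<le> J" using diff by simp
  have "integral\<^sup>L plane ?out \<le> (LINT z|plane. exp (- (k - 1) * L) * on_rect {0<..} {0<..} (weight 1 c m) z)"
  proof (rule integral_mono[OF out_int])
    show "integrable plane (\<lambda>z. exp (- (k - 1) * L) * on_rect {0<..} {0<..} (weight 1 c m) z)"
      using c m by (intro integrable_mult_right weight_integrable_quadrant) auto
    fix z :: "real \<times> real"
    obtain x y where z: "z = (x, y)" by (cases z)
    show "?out z \<le> exp (- (k - 1) * L) * on_rect {0<..} {0<..} (weight 1 c m) z"
    proof (cases "1 \<le> x \<and> \<rho> \<le> y \<and> (1 + e < x \<or> \<rho> + e < y)")
      case True
      then have "weight k c m x y \<le> exp (- (k - 1) * L) * weight 1 c m x y"
        unfolding L_def using c e ce k by (intro weight_le_outside_box) auto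
      then show ?thesis using True \<rho>0 unfolding z by auto
    next
      case False
      then have "?out z = 0" unfolding z by (auto simp: indicator_def)
      also have "0 \<le> exp (- (k - 1) * L) * on_rect {0<..} {0<..} (weight 1 c m) z"
        unfolding z by (simp add: weight_nonneg)
      finally show ?thesis .
    qed
  qed
  also have "\<dots> \<le> exp (- (k - 1) * L) * quadrant_bound c m"
    unfolding integral_mult_right_zero
    using c m by (intro mult_left_mono weight_quadrant_integral_le) auto
  finally show "J - J_box \<le> exp (- (k - 1) * L) * quadrant_bound c m" unfolding diff .
  have split: "weight k c m x y = weight k c 0 x y * (x * y) powr m" if "x > 0" "y > 0" for x y
    using that by (simp add: weight_def)
  have "\<rho> powr m * D = (LINT z|plane. \<rho> powr m * on_rect {1..1 + e} {\<rho>..\<rho> + e} (weight k c 0) z)"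
    unfolding D_def integral_mult_right_zero ..
  also have "\<dots> \<le> J_box" unfolding J_box_def
  proof (intro integral_mono integrable_mult_right box k m order.refl)
    fix z :: "real \<times> real"
    obtain x y where z: "z = (x, y)" by (cases z)
    show "\<rho> powr m * on_rect {1..1 + e} {\<rho>..\<rho> + e} (weight k c 0) z \<le> on_rect {1..1 + e} {\<rho>..\<rho> + e} (weight k c m) z"
    proof (cases "x \<in> {1..1 + e} \<and> y \<in> {\<rho>..\<rho> + e}")
      case True
      then have "1 * \<rho> \<le> x * y" using \<rho>0 by (intro mult_mono) auto
      then have "\<rho> powr m \<le> (x * y) powr m" using \<rho>0 m by (intro powr_mono2) auto
      from mult_left_mono[OF this weight_nonneg[of k c 0 x y]] True \<rho>0 show ?thesis
        unfolding z by (simp add: split mult_ac)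
    qed (auto simp: z)
  qed
  finally show "\<rho> powr m * D \<le> J_box" .
  have "J_box \<le> (LINT z|plane. ((1 + e) * (\<rho> + e)) powr m * on_rect {1..1 + e} {\<rho>..\<rho> + e} (weight k c 0) z)"
    unfolding J_box_def
  proof (intro integral_mono integrable_mult_right box k m order.refl)
    fix z :: "real \<times> real"
    obtain x y where z: "z = (x, y)" by (cases z)
    show "on_rect {1..1 + e} {\<rho>..\<rho> + e} (weight k c m) z \<le> ((1 + e) * (\<rho> + e)) powr m * on_rect {1..1 + e} {\<rho>..\<rho> + e} (weight k c 0) z"
    proof (cases "x \<in> {1..1 + e} \<and> y \<in> {\<rho>..\<rho> + e}")
      case True
      then have "x * y \<le> (1 + e) * (\<rho> + e)" using \<rho>0 by (intro mult_mono) auto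
      then have "(x * y) powr m \<le> ((1 + e) * (\<rho> + e)) powr m" using \<rho>0 m True by (intro powr_mono2) auto
      from mult_left_mono[OF this weight_nonneg[of k c 0 x y]] True \<rho>0 show ?thesis
        unfolding z by (simp add: split mult_ac)
    qed (auto simp: z)
  qed
  also have "\<dots> = ((1 + e) * (\<rho> + e)) powr m * D"
    unfolding D_def integral_mult_right_zero ..
  finally show "J_box \<le> ((1 + e) * (\<rho> + e)) powr m * D" .
qed

text \<open>Moving all parameters from one end of their ranges to the other along a segment, the product
  takes every value between the extreme ones. The factor \<open>1 - A3\<close> may become negative, so the
  parameters cannot be found by estimating one factor at a time.\<close>

lemma interpolate_product:
  fixes A2 A3 A4 A5 A6 K X :: real
  assumes A: "0 \<le> A2" "0 \<le> A3" "0 \<le> A4" "0 \<le> A5" "0 \<le> A6"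
    and lo: "(1 - A3) * (1 - A4) * (1 - A6) * K \<le> X" and up: "X \<le> (1 + A2) * (1 + A5) * K"
  shows "\<exists>t2 t3 t4 t5 t6. X = (1 + t2) * (1 - t3) * (1 - t4) * (1 + t5) * (1 - t6) * K \<and>
     0 \<le> t2 \<and> t2 \<le> A2 \<and> 0 \<le> t3 \<and> t3 \<le> A3 \<and> 0 \<le> t4 \<and> t4 \<le> A4 \<and>
     0 \<le> t5 \<and> t5 \<le> A5 \<and> 0 \<le> t6 \<and> t6 \<le> A6"
proof -
  define f where "f = (\<lambda>s. (1 + s * A2) * (1 - (1 - s) * A3) * (1 - (1 - s) * A4) * (1 + s * A5) * (1 - (1 - s) * A6) * K)"
  have "continuous_on {0..1} f" unfolding f_def by (intro continuous_intros)
  moreover have "f 0 \<le> X" "X \<le> f 1" using lo up by (simp_all add: f_def)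
  ultimately obtain s where s: "0 \<le> s" "s \<le> 1" "f s = X"
    using IVT'[of f 0 X 1] by auto
  have le: "0 \<le> r * B \<and> r * B \<le> B" if "0 \<le> r" "r \<le> 1" "0 \<le> B" for r B :: real
    using that by (auto intro: mult_left_le_one_le)
  show ?thesis
    by (rule exI[of _ "s * A2"], rule exI[of _ "(1 - s) * A3"], rule exI[of _ "(1 - s) * A4"],
        rule exI[of _ "s * A5"], rule exI[of _ "(1 - s) * A6"])
      (use s(3)[unfolded f_def] le[OF s(1,2)] le[of "1 - s"] s(1,2) A in simp)
qed

text \<open>The box carries the main term and the complement the remainder \<open>R\<close>. The product of the factors is
  not found factor by factor: the box integral is bounded below and above by the product at the two
  ends of the ranges, and \<open>interpolate_product\<close> supplies the parameters in between.\<close>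

lemma corner_integral_expansion:
  fixes c \<rho> k m e :: real
  assumes c: "0 < c" "c < 1" and k: "k \<ge> 1" and m: "m \<ge> 0" and e: "e > 0"
    and \<rho>: "c < \<rho>" "c * \<rho> < 1" and ce: "c * e < \<rho> - c" "c * e < 1 - c * \<rho>"
  defines "J \<equiv> integral\<^sup>L plane (on_rect {1..} {\<rho>..} (weight k c m))"
    and "q0 \<equiv> \<rho>\<^sup>2 - 2 * c * \<rho> + 1"
    and "t7 \<equiv> exp (- k * e * (2 * (1 - c * \<rho>) + e))"
    and "\<eta> \<equiv> e * (2 * min (\<rho> - c) (1 - c * \<rho>) + e)"
  shows "\<exists>t2 t3 t4 t5 t6 R.
      J / \<rho> powr (m + 1) = exp (- k * q0) * ((1 + t2) * (1 - t3) * (1 - t4) * (1 + t5) * (1 - t6) * (1 - t7)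
          / (4 * k\<^sup>2 * \<rho> * (\<rho> - c) * (1 - c * \<rho>)) + R) \<and>
      0 \<le> R \<and> R \<le> exp (- k * \<eta>) * exp (q0 + \<eta>) * (1 / \<rho> powr (m + 1) * quadrant_bound c m) \<and>
      0 \<le> t2 \<and> t2 \<le> ((1 + e) * (1 + e / \<rho>)) powr m - 1 \<and>
      0 \<le> t3 \<and> t3 \<le> e / (\<rho> - c) \<and>
      0 \<le> t4 \<and> t4 \<le> exp (- k * e * (2 * (\<rho> - c - c * e) + e)) \<and>
      0 \<le> t5 \<and> t5 \<le> c * e / (\<rho> - c - c * e) \<and>
      0 \<le> t6 \<and> t6 \<le> e / (1 - c * \<rho> + e)"
proof -
  define J_box where "J_box = integral\<^sup>L plane (on_rect {1..1 + e} {\<rho>..\<rho> + e} (weight k c m))"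
  define D where "D = integral\<^sup>L plane (on_rect {1..1 + e} {\<rho>..\<rho> + e} (weight k c 0))"
  define r where "r = \<rho> - c"
  define s where "s = 1 - c * \<rho>"
  have pos: "r > 0" "s > 0" "\<rho> > 0" "k > 0" "r - c * e > 0" using \<rho> c k ce by (auto simp: r_def s_def)
  define A4 where "A4 = exp (- k * e * (2 * (r - c * e) + e))"
  have A4: "0 \<le> A4" "A4 \<le> 1" using pos e by (auto simp: A4_def intro!: mult_nonneg_nonneg)
  have t7: "0 \<le> 1 - t7" using pos e unfolding t7_def s_def[symmetric] by (auto intro!: mult_nonneg_nonneg)
  define g where "g = exp (k * q0) * D"
  have g_le: "g \<le> (1 - t7) / (4 * k\<^sup>2 * (r - c * e) * s)"
    unfolding g_def D_def q0_def t7_def r_def s_def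
    by (rule box_gaussian_le[OF c k e \<rho> ce(1)])
  have g_ge: "(1 - A4) * (1 - t7) / (4 * k\<^sup>2 * (r + e) * (s + e)) \<le> g"
    unfolding g_def D_def q0_def t7_def A4_def r_def s_def
    by (rule box_gaussian_ge[OF c k e \<rho> ce(1)])
  define h where "h = exp (k * q0) * J_box / \<rho> powr (m + 1)"
  have \<rho>m: "\<rho> powr (m + 1) = \<rho> powr m * \<rho>" "\<rho> powr m > 0" using pos by (auto simp: powr_add)
  have h_ge: "g / \<rho> \<le> h"
  proof -
    have "exp (k * q0) * (\<rho> powr m * D) / \<rho> powr (m + 1) \<le> h"
      unfolding h_def J_box_def D_def using box_integral_ge[OF c k m e \<rho> ce]
      by (intro divide_right_mono mult_left_mono) auto
    then show ?thesis using \<rho>m pos by (simp add: g_def)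
  qed
  define A2 where "A2 = ((1 + e) * (1 + e / \<rho>)) powr m - 1"
  have A2: "A2 \<ge> 0"
  proof -
    have "1 * 1 \<le> (1 + e) * (1 + e / \<rho>)" using e pos by (intro mult_mono) auto
    then show ?thesis using m by (simp add: A2_def ge_one_powr_ge_zero)
  qed
  have h_le: "h \<le> (1 + A2) * g / \<rho>"
  proof -
    have "(1 + e) * (\<rho> + e) = ((1 + e) * (1 + e / \<rho>)) * \<rho>" using pos by (simp add: field_simps)
    then have "((1 + e) * (\<rho> + e)) powr m = ((1 + e) * (1 + e / \<rho>)) powr m * \<rho> powr m"
      using e pos by (simp only: powr_mult)
    then have eq: "((1 + e) * (\<rho> + e)) powr m = (1 + A2) * \<rho> powr m" by (simp add: A2_def)
    have "h \<le> exp (k * q0) * (((1 + e) * (\<rho> + e)) powr m * D) / \<rho> powr (m + 1)"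
      unfolding h_def J_box_def D_def using box_integral_le[OF c k m e \<rho> ce]
      by (intro divide_right_mono mult_left_mono) auto
    also have "\<dots> = (1 + A2) * g / \<rho>" unfolding eq using \<rho>m pos by (simp add: g_def)
    finally show ?thesis .
  qed
  define C where "C = 4 * k\<^sup>2 * \<rho> * r * s"
  have C: "C > 0" using pos by (simp add: C_def)
  define A3 where "A3 = e / r"
  define A5 where "A5 = c * e / (r - c * e)"
  define A6 where "A6 = e / (s + e)"
  have A: "A3 \<ge> 0" "A5 \<ge> 0" "A6 \<ge> 0" using pos e c by (auto simp: A3_def A5_def A6_def)
  have lo: "(1 - A3) * (1 - A4) * (1 - A6) * (1 - t7) \<le> C * h"
  proof -
    \<comment> \<open>\<open>1 - A3\<close> may be negative, so it is compared with \<open>r / (r + e)\<close> before the positive factors are multiplied in\<close>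
    have "(1 - A3) * (r + e) = (r\<^sup>2 - e\<^sup>2) / r" using pos by (simp add: A3_def power2_eq_square field_simps)
    also have "\<dots> \<le> r" using pos by (simp add: divide_le_eq power2_eq_square)
    finally have "1 - A3 \<le> r / (r + e)" using pos e by (simp add: le_divide_eq)
    moreover have "1 - A6 = s / (s + e)" using pos e by (simp add: A6_def field_simps)
    ultimately have "(1 - A3) * ((1 - A4) * (1 - A6) * (1 - t7)) \<le> r / (r + e) * ((1 - A4) * (s / (s + e)) * (1 - t7))"
      using A4 t7 pos e by (intro mult_mono mult_nonneg_nonneg) auto
    also have "\<dots> = C * ((1 - A4) * (1 - t7) / (4 * k\<^sup>2 * (r + e) * (s + e)) / \<rho>)"
      using pos e by (simp add: C_def divide_simps)
    also have "\<dots> \<le> C * (g / \<rho>)" using C pos g_ge by (intro mult_left_mono divide_right_mono) auto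
    also have "\<dots> \<le> C * h" using C h_ge by (intro mult_left_mono) auto
    finally show ?thesis by (simp add: mult_ac)
  qed
  have up: "C * h \<le> (1 + A2) * (1 + A5) * (1 - t7)"
  proof -
    have "C * h \<le> C * ((1 + A2) * g / \<rho>)" using C h_le by (intro mult_left_mono) auto
    also have "\<dots> \<le> C * ((1 + A2) * ((1 - t7) / (4 * k\<^sup>2 * (r - c * e) * s)) / \<rho>)"
      using C pos g_le A2 by (intro mult_left_mono divide_right_mono) auto
    also have "\<dots> = (1 + A2) * (r / (r - c * e)) * (1 - t7)"
      using pos by (simp add: C_def divide_simps)
    also have "r / (r - c * e) = 1 + A5" using pos by (simp add: A5_def field_simps)
    finally show ?thesis .
  qed
  obtain t2 t3 t4 t5 t6 where t: "C * h = (1 + t2) * (1 - t3) * (1 - t4) * (1 + t5) * (1 - t6) * (1 - t7)"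
     "0 \<le> t2" "t2 \<le> A2" "0 \<le> t3" "t3 \<le> A3" "0 \<le> t4" "t4 \<le> A4" "0 \<le> t5" "t5 \<le> A5" "0 \<le> t6" "t6 \<le> A6"
    using interpolate_product[OF A2 A(1) A4(1) A(2,3) lo up] by blast
  define R where "R = exp (k * q0) * (J - J_box) / \<rho> powr (m + 1)"
  have R0: "0 \<le> R"
    using box_integral_le_corner[OF c k m e \<rho> ce] unfolding R_def J_def J_box_def
    by (intro divide_nonneg_nonneg mult_nonneg_nonneg) auto
  have R_le: "R \<le> exp (- k * \<eta>) * exp (q0 + \<eta>) * (1 / \<rho> powr (m + 1) * quadrant_bound c m)"
  proof -
    have "R \<le> exp (k * q0) * (exp (- (k - 1) * (q0 + \<eta>)) * quadrant_bound c m) / \<rho> powr (m + 1)"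
      using corner_minus_box_le[OF c k m e \<rho> ce] unfolding R_def J_def J_box_def q0_def \<eta>_def
      by (intro divide_right_mono mult_left_mono) auto
    also have "\<dots> = (exp (k * q0) * exp (- (k - 1) * (q0 + \<eta>))) * (1 / \<rho> powr (m + 1) * quadrant_bound c m)"
      by simp
    also have "exp (k * q0) * exp (- (k - 1) * (q0 + \<eta>)) = exp (- k * \<eta>) * exp (q0 + \<eta>)"
      unfolding exp_add[symmetric] by (simp add: algebra_simps)
    finally show ?thesis .
  qed
  have "exp (- k * q0) * (C * h / C + R) = exp (- k * q0) * exp (k * q0) * (J / \<rho> powr (m + 1))"
    using C unfolding h_def R_def by (simp add: diff_divide_distrib algebra_simps)
  also have "exp (- k * q0) * exp (k * q0) = 1" by (simp flip: exp_add)
  finally have "J / \<rho> powr (m + 1) = exp (- k * q0) * (C * h / C + R)" by simp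
  then have "J / \<rho> powr (m + 1) = exp (- k * q0) *
      ((1 + t2) * (1 - t3) * (1 - t4) * (1 + t5) * (1 - t6) * (1 - t7) / C + R)" unfolding t(1) .
  note results = this R0 R_le t(2-11)
  show ?thesis
    by (rule exI[of _ t2], rule exI[of _ t3], rule exI[of _ t4], rule exI[of _ t5], rule exI[of _ t6],
        rule exI[of _ R], intro conjI)
      (fact results[unfolded C_def A2_def A3_def A4_def A5_def A6_def r_def s_def])+
qed

section \<open>The limit probability as a weighted Gaussian integral\<close>

lemma half_square_substitution:
  fixes f :: "real \<Rightarrow> real" and a l :: real
  assumes [measurable]: "f \<in> borel_measurable borel" and a: "a > 0" and l: "l > 0"
  shows "(LBINT u:{a * l\<^sup>2 / 2..}. f u) = (LBINT t:{l..}. a * t * f (a * t\<^sup>2 / 2))"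
proof -
  let ?g = "\<lambda>t::real. a * t\<^sup>2 / 2"
  have img: "?g ` {l..} = {a * l\<^sup>2 / 2..}"
  proof (intro equalityI subsetI)
    fix y assume y: "y \<in> {a * l\<^sup>2 / 2..}"
    then have "l\<^sup>2 \<le> 2 * y / a" using a by (simp add: field_simps)
    then have "l \<le> sqrt (2 * y / a)" and "0 \<le> 2 * y / a" using l by (auto intro: real_le_rsqrt order.trans[OF zero_le_power2])
    then show "y \<in> ?g ` {l..}" using a by (intro image_eqI[of _ _ "sqrt (2 * y / a)"]) auto
  next
    fix y assume "y \<in> ?g ` {l..}"
    then show "y \<in> {a * l\<^sup>2 / 2..}" using a l by (auto intro!: divide_right_mono mult_left_mono power_mono)
  qed
  have inj: "inj_on ?g {l..}" using a l by (auto intro!: inj_onI simp: power2_eq_iff)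
  have d: "(?g has_field_derivative a * x) (at x within {l..})" for x
    by (auto intro!: derivative_eq_intros)
  have "(LBINT u:{a * l\<^sup>2 / 2..}. f u) = (LBINT t:{l..}. \<bar>a * t\<bar> * f (?g t))"
    using set_lebesgue_integral_change_of_variables(2)[of f ?g "\<lambda>t. a * t" "{l..}", unfolded img, OF _ _ _ _ _ d inj]
    by simp
  also have "\<dots> = (LBINT t:{l..}. a * t * f (?g t))"
    using a l by (intro set_lebesgue_integral_cong) auto
  finally show ?thesis .
qed

lemma bessel_I_measurable [measurable]: "bessel_I \<nu> \<in> borel_measurable borel"
  unfolding bessel_I_def by measurable

lemma scaled_bessel_measurable [measurable]: "scaled_bessel \<nu> \<in> borel_measurable borel"
  unfolding scaled_bessel_def by measurable

lemma p20_measurable [measurable (raw)]: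
  assumes [measurable]: "f \<in> borel_measurable M" "g \<in> borel_measurable M"
  shows "(\<lambda>x. p20 N c (f x) (g x)) \<in> borel_measurable M"
  unfolding p20_def Let_def by measurable

text \<open>The bookkeeping of constants and powers in the substitution, with \<open>2 * c * y\<close> the
  argument of the Infeld function. All bases are positive, so it suffices to compare logarithms.\<close>

lemma density_constant_identity:
  fixes \<beta> c y q d :: real
  assumes "\<beta> > 0" "c > 0" "y > 0" "q > 0"
  shows "\<beta> powr (1 + d) / (c powr d * \<beta>\<^sup>2) * y powr d * (q * (2 * \<beta> * y)) / sqrt (2 * pi * (2 * c * y))
     = (q\<^sup>2) powr ((2 * d + 3) / 4) / ((2 * c) powr (d + 1/2) * sqrt (pi * \<beta>)) * (2 * \<beta> * y / q) powr (d + 1/2)"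
  (is "?L = ?R")
proof -
  have ln2: "ln 4 = 2 * ln (2::real)" using ln_realpow[of 2 2] by simp
  have "ln ?L = ln ?R"
    using assms by (simp add: ln_mult ln_div ln_powr ln_sqrt ln_realpow ln2 field_simps)
  then show ?thesis using assms by (subst (asm) ln_inj_iff) auto
qed

text \<open>Using the same scale \<open>a = x1\<close> for both variables makes the quadratic form symmetric and puts
  \<open>\<rho>\<close> into the limits of integration instead. The factor \<open>exp z\<close> of the leading term
  of the Infeld function supplies the mixed term \<open>2 * c * x * y\<close> of the form.\<close>

lemma p20_half_squares:
  fixes N :: nat and c a x y :: real
  assumes N: "N \<ge> 3" and c: "0 < c" "c < 1" and a: "a > 0" and xy: "x > 0" "y > 0"
  shows "a * x * (a * y * p20 N c (a * x\<^sup>2 / 2) (a * y\<^sup>2 / 2)) =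
    (a\<^sup>2) powr (real N / 4) / ((2 * c) powr (real N / 2 - 1) * Gamma ((real N - 1) / 2) * sqrt (pi * (1 - c\<^sup>2)))
     * (weight (a / (2 * (1 - c\<^sup>2))) c (real N / 2 - 1) x y * scaled_bessel ((real N - 3) / 2) (c * a * (x * y) / (1 - c\<^sup>2)))"
proof -
  define \<beta> where "\<beta> = 1 - c\<^sup>2"
  define d where "d = (real N - 3) / 2"
  have \<beta>: "\<beta> > 0" using c by (simp add: \<beta>_def abs_square_less_1)
  define w where "w = a * (x * y) / (2 * \<beta>)"
  have w: "w > 0" using a xy \<beta> by (simp add: w_def)
  define z where "z = 2 * c * w"
  have z: "z > 0" using c w by (simp add: z_def)
  have "d \<ge> 0" using N by (simp add: d_def)
  then have G: "Gamma (1 + d) > 0" by (intro Gamma_real_pos) simp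
  have sq: "sqrt (a * x\<^sup>2 / 2 * (a * y\<^sup>2 / 2)) = a * (x * y) / 2"
    by (rule real_sqrt_unique) (use a xy in \<open>auto simp: power2_eq_square\<close>)
  have z1: "2 * c * sqrt (a * x\<^sup>2 / 2 * (a * y\<^sup>2 / 2)) / \<beta> = z"
    unfolding sq by (simp add: z_def w_def)
  have z2: "c * a * (x * y) / \<beta> = z" using \<beta> by (simp add: z_def w_def)
  have ww: "(a * x\<^sup>2 / 2 * (a * y\<^sup>2 / 2) / \<beta>\<^sup>2) powr (d / 2) = w powr d"
  proof -
    have "a * x\<^sup>2 / 2 * (a * y\<^sup>2 / 2) / \<beta>\<^sup>2 = w powr 2" using w by (simp add: w_def power2_eq_square)
    then show ?thesis by (simp add: powr_powr)
  qed
  have bes: "bessel_I d z = scaled_bessel d z * exp z / sqrt (2 * pi * z)"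
    using z by (simp add: scaled_bessel_def exp_minus)
  have inv: "(1 / \<beta>) powr (1 + d) = 1 / \<beta> powr (1 + d)" using \<beta> by (simp add: powr_divide)
  have ex: "exp (- (a * x\<^sup>2 / 2 / \<beta> + a * y\<^sup>2 / 2 / \<beta>)) * exp z
      = exp (- (a / (2 * \<beta>)) * (x\<^sup>2 - 2 * c * x * y + y\<^sup>2))"
    unfolding exp_add[symmetric] z_def w_def using \<beta> by (simp add: field_simps)
  have N4: "real N / 4 = (2 * d + 3) / 4" and N2: "real N / 2 - 1 = d + 1/2" and N1: "(real N - 1) / 2 = 1 + d"
    by (auto simp: d_def field_simps)
  have xyw: "x * y = 2 * \<beta> * w / a" using a \<beta> by (simp add: w_def)
  have "a * x * (a * y * p20 N c (a * x\<^sup>2 / 2) (a * y\<^sup>2 / 2))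
     = a * (a * (x * y)) * (exp (- (a * x\<^sup>2 / 2 / \<beta> + a * y\<^sup>2 / 2 / \<beta>)) / (1 / \<beta> powr (1 + d) * c powr d * Gamma (1 + d) * \<beta>\<^sup>2)
       * w powr d * (scaled_bessel d z * exp z / sqrt (2 * pi * z)))"
    unfolding p20_def Let_def \<beta>_def[symmetric] d_def[symmetric] z1 ww bes inv by (simp add: mult_ac)
  also have "a * (x * y) = 2 * \<beta> * w" using a \<beta> by (simp add: w_def)
  also have "a * (2 * \<beta> * w) * (exp (- (a * x\<^sup>2 / 2 / \<beta> + a * y\<^sup>2 / 2 / \<beta>)) / (1 / \<beta> powr (1 + d) * c powr d * Gamma (1 + d) * \<beta>\<^sup>2)
       * w powr d * (scaled_bessel d z * exp z / sqrt (2 * pi * z)))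
     = (\<beta> powr (1 + d) / (c powr d * \<beta>\<^sup>2) * w powr d * (a * (2 * \<beta> * w)) / sqrt (2 * pi * (2 * c * w)))
       * (exp (- (a * x\<^sup>2 / 2 / \<beta> + a * y\<^sup>2 / 2 / \<beta>)) * exp z) * scaled_bessel d z / Gamma (1 + d)"
    unfolding z_def[symmetric] by (simp add: mult_ac)
  also have "\<dots> = (a\<^sup>2) powr ((2 * d + 3) / 4) / ((2 * c) powr (d + 1/2) * sqrt (pi * \<beta>)) * (2 * \<beta> * w / a) powr (d + 1/2)
       * (exp (- (a / (2 * \<beta>)) * (x\<^sup>2 - 2 * c * x * y + y\<^sup>2))) * scaled_bessel d z / Gamma (1 + d)"
    unfolding ex density_constant_identity[OF \<beta> c(1) w a] ..
  finally show ?thesis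
    unfolding \<beta>_def[symmetric] d_def[symmetric] N4 N2 N1 weight_def xyw[symmetric] z2 by (simp add: mult_ac)
qed

text \<open>The pairs \<open>(nat \<lfloor>c\<^sup>2 * n\<rfloor>, n)\<close> run through the regime as \<open>n\<close> grows. Hence limits along it are
  unique, and \<open>alpha\<close>, a \<open>Lim\<close>, is the limit supplied by the known formula.\<close>

lemma regime_nontrivial:
  assumes c: "0 < c" "c < 1" shows "regime c \<noteq> bot"
proof -
  define n1 where "n1 = (\<lambda>n. nat \<lfloor>c\<^sup>2 * real n\<rfloor>)"
  have c2: "0 < c\<^sup>2" "c\<^sup>2 < 1" using c by (auto simp: abs_square_less_1)
  have n1: "c\<^sup>2 * real n - 1 < real (n1 n)" "real (n1 n) \<le> c\<^sup>2 * real n" for n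
    using c2 by (auto simp: n1_def of_nat_nat)
  have lim: "(\<lambda>n. real (n1 n) / real n) \<longlonglongrightarrow> c\<^sup>2"
  proof (rule tendsto_sandwich[where f = "\<lambda>n. c\<^sup>2 - 1 / real n" and h = "\<lambda>n. c\<^sup>2"])
    show "\<forall>\<^sub>F n in sequentially. c\<^sup>2 - 1 / real n \<le> real (n1 n) / real n"
      using eventually_gt_at_top[of 0]
    proof eventually_elim
      case (elim n)
      have "(c\<^sup>2 * real n - 1) / real n \<le> real (n1 n) / real n"
        using n1(1)[of n] by (intro divide_right_mono) auto
      then show ?case using elim by (simp add: diff_divide_distrib)
    qed
    show "\<forall>\<^sub>F n in sequentially. real (n1 n) / real n \<le> c\<^sup>2"
      using eventually_gt_at_top[of 0] by eventually_elim (use n1(2) in \<open>auto simp: field_simps\<close>)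
    show "(\<lambda>n. c\<^sup>2 - 1 / real n) \<longlonglongrightarrow> c\<^sup>2"
      using tendsto_diff[OF tendsto_const lim_1_over_n, of "c\<^sup>2"] by simp
  qed simp
  have top: "filterlim n1 at_top sequentially"
  proof -
    have "filterlim (\<lambda>n. - 1 + c\<^sup>2 * real n) at_top sequentially"
      using c2 by (intro filterlim_tendsto_add_at_top[OF tendsto_const] filterlim_tendsto_pos_mult_at_top[OF tendsto_const _ filterlim_real_sequentially])
    then have "filterlim (\<lambda>n. real (n1 n)) at_top sequentially"
      by (rule filterlim_at_top_mono) (use n1(1) in \<open>auto intro!: always_eventually less_imp_le simp: less_diff_eq diff_less_eq add.commute\<close>)
    then have "\<forall>\<^sub>F n in sequentially. real Z \<le> real (n1 n)" for Z
      unfolding filterlim_at_top by blast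
    then show ?thesis unfolding filterlim_at_top by simp
  qed
  have "filterlim (\<lambda>n. (n1 n, n)) (regime c) sequentially"
    unfolding regime_def
  proof (intro filterlim_inf[THEN iffD2] conjI)
    show "filterlim (\<lambda>n. (n1 n, n)) (at_top \<times>\<^sub>F at_top) sequentially"
      by (intro filterlim_Pair top filterlim_ident)
    have less: "n1 n < n" if "n > 0" for n
    proof -
      have "c\<^sup>2 * real n < 1 * real n" using that c2 by (intro mult_strict_right_mono) auto
      then have "real (n1 n) < real n" using n1(2)[of n] by linarith
      then show ?thesis by simp
    qed
    show "filterlim (\<lambda>n. (n1 n, n)) (principal {(n1, n2). n1 < n2}) sequentially"
      by (auto simp: filterlim_principal less intro!: eventually_mono[OF eventually_gt_at_top[of 0]])
    show "filterlim (\<lambda>n. (n1 n, n)) (filtercomap (\<lambda>(n1, n2). sqrt (real n1 / real n2)) (nhds c)) sequentially"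
      unfolding filterlim_filtercomap_iff using tendsto_real_sqrt[OF lim] c by (simp add: o_def)
  qed
  then show ?thesis
    by (auto simp: filterlim_def filtermap_bot_iff bot_unique le_bot)
qed

lemma relative_error_exists:
  fixes A I P :: real
  assumes "\<bar>A - I\<bar> \<le> P * I" "I \<ge> 0" "P \<ge> 0"
  shows "\<exists>\<theta>. A = I * (1 + \<theta>) \<and> \<bar>\<theta>\<bar> \<le> P"
proof (cases "I = 0")
  case True
  then show ?thesis using assms by (intro exI[of _ 0]) auto
next
  case False
  then have "I > 0" using assms by simp
  then show ?thesis using assms
    by (intro exI[of _ "(A - I) / I"]) (auto simp: field_simps abs_le_iff)
qed

text \<open>On the quadrant \<open>x * y \<ge> \<rho>\<close>, so the argument of the Infeld function is at least its value at the
  corner. Its relative error is thus at most \<open>P\<close> there, and integrating this against the nonnegative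
  weight gives the claim.\<close>

lemma tail_integral_relative_error:
  fixes N :: nat and c a \<rho> :: real
  assumes N: "N \<ge> 3" and c: "0 < c" "c < 1" and a: "a > 0" and \<rho>: "\<rho> > 0"
    and lam: "a / (2 * (1 - c\<^sup>2)) \<ge> 1"
    and large: "N > 4 \<Longrightarrow> real N / 4 - 1 < c * a * \<rho> / (1 - c\<^sup>2)"
    and three: "N = 3 \<Longrightarrow> 3/4 < c * a * \<rho> / (1 - c\<^sup>2)"
  defines "J \<equiv> integral\<^sup>L plane (on_rect {1..} {\<rho>..} (weight (a / (2 * (1 - c\<^sup>2))) c (real N / 2 - 1)))"
    and "K \<equiv> (a\<^sup>2) powr (real N / 4) / ((2 * c) powr (real N / 2 - 1) * Gamma ((real N - 1) / 2) * sqrt (pi * (1 - c\<^sup>2)))"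
    and "P \<equiv> Psi ((real N - 3) / 2) (c * a * \<rho> / (1 - c\<^sup>2))"
  shows "\<exists>\<theta>. (LBINT u1:{a / 2..}. (LBINT u2:{a * \<rho>\<^sup>2 / 2..}. p20 N c u1 u2)) = K * J * (1 + \<theta>) \<and> \<bar>\<theta>\<bar> \<le> P"
proof -
  define m where "m = real N / 2 - 1"
  define k where "k = a / (2 * (1 - c\<^sup>2))"
  define R where "R = (\<lambda>x y. scaled_bessel ((real N - 3) / 2) (c * a * (x * y) / (1 - c\<^sup>2)))"
  have m: "m \<ge> 0" using N by (simp add: m_def)
  have b: "1 - c\<^sup>2 > 0" using c by (simp add: abs_square_less_1)
  have Rm [measurable]: "(\<lambda>(x, y). R x y) \<in> borel_measurable (borel \<Otimes>\<^sub>M borel)"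
    unfolding R_def by measurable
  define z0 where "z0 = c * a * \<rho> / (1 - c\<^sup>2)"
  have z0: "z0 > 0" using c a \<rho> b by (simp add: z0_def)
  have R_bound: "\<bar>R x y - 1\<bar> \<le> P" if "1 \<le> x" "\<rho> \<le> y" for x y
  proof -
    have "1 * \<rho> \<le> x * y" using that \<rho> by (intro mult_mono) auto
    then have "z0 \<le> c * a * (x * y) / (1 - c\<^sup>2)"
      unfolding z0_def using c a b by (intro divide_right_mono mult_left_mono) auto
    then show ?thesis
      unfolding R_def P_def z0_def[symmetric]
      by (intro scaled_bessel_within_Psi N z0) (use large three in \<open>auto simp: z0_def\<close>)
  qed
  have P0: "P \<ge> 0" using R_bound[of 1 \<rho>] by simp
  have int_w: "integrable plane (on_rect {1..} {\<rho>..} (weight k c m))"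
    by (rule integrable_on_subrect[OF weight_integrable_quadrant[OF c m lam[folded k_def]]]) (use \<rho> in auto)
  have int_wR: "integrable plane (on_rect {1..} {\<rho>..} (\<lambda>x y. weight k c m x y * R x y))"
  proof (rule Bochner_Integration.integrable_bound[OF integrable_mult_right[OF int_w, of "1 + P"]])
    show "on_rect {1..} {\<rho>..} (\<lambda>x y. weight k c m x y * R x y) \<in> borel_measurable plane"
      unfolding R_def by measurable
    have "norm (on_rect {1..} {\<rho>..} (\<lambda>x y. weight k c m x y * R x y) (x, y))
       \<le> norm ((1 + P) * on_rect {1..} {\<rho>..} (weight k c m) (x, y))" for x y
    proof (cases "1 \<le> x \<and> \<rho> \<le> y")
      case True
      then have "\<bar>R x y\<bar> \<le> 1 + P" using R_bound[of x y] by linarith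
      then have "weight k c m x y * \<bar>R x y\<bar> \<le> weight k c m x y * (1 + P)"
        by (intro mult_left_mono weight_nonneg)
      then show ?thesis using True P0 by (simp add: abs_mult weight_nonneg mult_ac)
    qed auto
    then show "AE z in plane. norm (on_rect {1..} {\<rho>..} (\<lambda>x y. weight k c m x y * R x y) z)
       \<le> norm ((1 + P) * on_rect {1..} {\<rho>..} (weight k c m) z)" by (intro AE_I2) auto
  qed
  define W where "W = integral\<^sup>L plane (on_rect {1..} {\<rho>..} (\<lambda>x y. weight k c m x y * R x y))"
  have J: "J = integral\<^sup>L plane (on_rect {1..} {\<rho>..} (weight k c m))"
    unfolding J_def k_def m_def ..
  have "\<bar>W - J\<bar> \<le> P * J"
  proof -
    have diff: "W - J = (LINT z|plane. on_rect {1..} {\<rho>..} (\<lambda>x y. weight k c m x y * R x y) z - on_rect {1..} {\<rho>..} (weight k c m) z)"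
      unfolding W_def J by (intro Bochner_Integration.integral_diff[symmetric] int_w int_wR)
    have "norm (W - J) \<le> (LINT z|plane. norm (on_rect {1..} {\<rho>..} (\<lambda>x y. weight k c m x y * R x y) z - on_rect {1..} {\<rho>..} (weight k c m) z))"
      unfolding diff by (rule integral_norm_bound)
    also have "\<dots> \<le> (LINT z|plane. P * on_rect {1..} {\<rho>..} (weight k c m) z)"
    proof (intro integral_mono integrable_norm Bochner_Integration.integrable_diff integrable_mult_right int_w int_wR)
      fix z :: "real \<times> real"
      obtain x y where z: "z = (x, y)" by (cases z)
      show "norm (on_rect {1..} {\<rho>..} (\<lambda>x y. weight k c m x y * R x y) z - on_rect {1..} {\<rho>..} (weight k c m) z)
        \<le> P * on_rect {1..} {\<rho>..} (weight k c m) z"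
      proof (cases "1 \<le> x \<and> \<rho> \<le> y")
        case True
        have "weight k c m x y * R x y - weight k c m x y = weight k c m x y * (R x y - 1)" by (simp add: algebra_simps)
        then have "\<bar>weight k c m x y * R x y - weight k c m x y\<bar> = weight k c m x y * \<bar>R x y - 1\<bar>"
          by (simp add: abs_mult weight_nonneg)
        also have "\<dots> \<le> weight k c m x y * P"
          using True by (intro mult_left_mono R_bound weight_nonneg) auto
        finally show ?thesis using True by (simp add: z mult_ac)
      qed (auto simp: z)
    qed
    also have "\<dots> = P * J" unfolding J by (rule integral_mult_right_zero)
    finally show ?thesis by simp
  qed
  moreover have "J \<ge> 0" unfolding J
    by (intro Bochner_Integration.integral_nonneg) (auto simp: weight_nonneg)
  ultimately obtain \<theta> where \<theta>: "W = J * (1 + \<theta>)" "\<bar>\<theta>\<bar> \<le> P"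
    using relative_error_exists[of W J P] P0 by blast
  have "(LBINT u1:{a / 2..}. (LBINT u2:{a * \<rho>\<^sup>2 / 2..}. p20 N c u1 u2))
      = (LBINT x:{1..}. a * x * (LBINT u2:{a * \<rho>\<^sup>2 / 2..}. p20 N c (a * x\<^sup>2 / 2) u2))"
  proof -
    have "(\<lambda>u1. LBINT u2:{a * \<rho>\<^sup>2 / 2..}. p20 N c u1 u2) \<in> borel_measurable borel"
      unfolding set_lebesgue_integral_def by measurable
    from half_square_substitution[OF this a, of 1] show ?thesis by simp
  qed
  also have "\<dots> = (LBINT x:{1..}. (LBINT y:{\<rho>..}. K * (weight k c m x y * R x y)))"
  proof (rule set_lebesgue_integral_cong)
    show "\<forall>x. x \<in> {1..} \<longrightarrow> a * x * (LBINT u2:{a * \<rho>\<^sup>2 / 2..}. p20 N c (a * x\<^sup>2 / 2) u2)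
        = (LBINT y:{\<rho>..}. K * (weight k c m x y * R x y))"
    proof (intro allI impI)
      fix x :: real assume x: "x \<in> {1..}"
      have "a * x * (LBINT u2:{a * \<rho>\<^sup>2 / 2..}. p20 N c (a * x\<^sup>2 / 2) u2)
          = a * x * (LBINT y:{\<rho>..}. a * y * p20 N c (a * x\<^sup>2 / 2) (a * y\<^sup>2 / 2))"
        using a \<rho> by (subst half_square_substitution) auto
      also have "\<dots> = (LBINT y:{\<rho>..}. a * x * (a * y * p20 N c (a * x\<^sup>2 / 2) (a * y\<^sup>2 / 2)))"
        by (rule set_integral_mult_right[symmetric])
      also have "\<dots> = (LBINT y:{\<rho>..}. K * (weight k c m x y * R x y))"
      proof (rule set_lebesgue_integral_cong)
        show "\<forall>y. y \<in> {\<rho>..} \<longrightarrow> a * x * (a * y * p20 N c (a * x\<^sup>2 / 2) (a * y\<^sup>2 / 2)) = K * (weight k c m x y * R x y)"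
          using x \<rho> p20_half_squares[OF N c a, of x] unfolding K_def k_def m_def R_def by auto
      qed simp
      finally show "a * x * (LBINT u2:{a * \<rho>\<^sup>2 / 2..}. p20 N c (a * x\<^sup>2 / 2) u2)
        = (LBINT y:{\<rho>..}. K * (weight k c m x y * R x y))" .
    qed
  qed simp
  also have "\<dots> = K * (LBINT x:{1..}. (LBINT y:{\<rho>..}. weight k c m x y * R x y))"
    unfolding set_integral_mult_right ..
  also have "\<dots> = K * W"
    unfolding W_def iterated_eq_plane_integral[OF int_wR] ..
  finally show ?thesis using \<theta> by (auto simp: mult.assoc)
qed

lemma rescaled_weight_integral:
  fixes c k m \<rho> :: real
  assumes c: "0 < c" "c < 1" and k: "k \<ge> 1" and m: "m \<ge> 0" and \<rho>: "\<rho> > 0"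
  shows "(LBINT t1:{1..}. (LBINT t2:{1..}.
      exp (- k * (t1\<^sup>2 - 2 * c * \<rho> * t1 * t2 + \<rho>\<^sup>2 * t2\<^sup>2)) * (t1 * t2) powr m))
    = integral\<^sup>L plane (on_rect {1..} {\<rho>..} (weight k c m)) / \<rho> powr (m + 1)"
proof -
  have int_w: "integrable plane (on_rect {1..} {\<rho>..} (weight k c m))"
    by (rule integrable_on_subrect[OF weight_integrable_quadrant[OF c m k]]) (use \<rho> in auto)
  have inner: "(LBINT t2:{1..}. exp (- k * (t1\<^sup>2 - 2 * c * \<rho> * t1 * t2 + \<rho>\<^sup>2 * t2\<^sup>2)) * (t1 * t2) powr m)
      = 1 / \<rho> powr (m + 1) * (LBINT y:{\<rho>..}. weight k c m t1 y)" if t1: "t1 \<in> {1..}" for t1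
  proof -
    have "(LBINT y:{\<rho>..}. weight k c m t1 y) = \<rho> * (LBINT t. indicator {\<rho>..} (\<rho> * t) * weight k c m t1 (\<rho> * t))"
      using lborel_integral_real_affine[of \<rho> "\<lambda>y. indicator {\<rho>..} y * weight k c m t1 y" 0] \<rho>
      by (simp add: set_lebesgue_integral_def)
    also have "(\<lambda>t. indicator {\<rho>..} (\<rho> * t) * weight k c m t1 (\<rho> * t))
       = (\<lambda>t. \<rho> powr m * (indicator {1..} t * (exp (- k * (t1\<^sup>2 - 2 * c * \<rho> * t1 * t + \<rho>\<^sup>2 * t\<^sup>2)) * (t1 * t) powr m)))"
    proof
      fix t
      have e: "t1\<^sup>2 - 2 * c * t1 * (\<rho> * t) + (\<rho> * t)\<^sup>2 = t1\<^sup>2 - 2 * c * \<rho> * t1 * t + \<rho>\<^sup>2 * t\<^sup>2"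
        by (simp add: power_mult_distrib mult_ac)
      have "(t1 * (\<rho> * t)) powr m = \<rho> powr m * (t1 * t) powr m" if "1 \<le> t"
        using powr_mult[of \<rho> "t1 * t" m] that t1 \<rho> by (simp add: mult_ac del: powr_mult)
      then show "indicator {\<rho>..} (\<rho> * t) * weight k c m t1 (\<rho> * t)
        = \<rho> powr m * (indicator {1..} t * (exp (- k * (t1\<^sup>2 - 2 * c * \<rho> * t1 * t + \<rho>\<^sup>2 * t\<^sup>2)) * (t1 * t) powr m))"
        unfolding weight_def e using \<rho> by (simp add: indicator_def)
    qed
    finally have "(LBINT y:{\<rho>..}. weight k c m t1 y) = \<rho> * \<rho> powr m *
        (LBINT t2:{1..}. exp (- k * (t1\<^sup>2 - 2 * c * \<rho> * t1 * t2 + \<rho>\<^sup>2 * t2\<^sup>2)) * (t1 * t2) powr m)"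
      by (simp add: set_lebesgue_integral_def)
    moreover have "\<rho> * \<rho> powr m = \<rho> powr (m + 1)" using \<rho> by (simp add: powr_add)
    ultimately show ?thesis using \<rho> by simp
  qed
  have "(LBINT t1:{1..}. (LBINT t2:{1..}.
      exp (- k * (t1\<^sup>2 - 2 * c * \<rho> * t1 * t2 + \<rho>\<^sup>2 * t2\<^sup>2)) * (t1 * t2) powr m))
    = (LBINT t1:{1..}. 1 / \<rho> powr (m + 1) * (LBINT y:{\<rho>..}. weight k c m t1 y))"
    by (rule set_lebesgue_integral_cong) (simp, use inner in blast)
  also have "\<dots> = 1 / \<rho> powr (m + 1) * (LBINT t1:{1..}. (LBINT y:{\<rho>..}. weight k c m t1 y))"
    by (rule set_integral_mult_right)
  finally show ?thesis unfolding iterated_eq_plane_integral[OF int_w] by simp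
qed

section \<open>The expansion of the limit probability\<close>

theorem proposition1:
  fixes M :: "'a measure" and N :: nat and p :: "nat \<Rightarrow> real" and T :: "nat \<Rightarrow> 'a \<Rightarrow> nat"
    and c x1 x2 \<rho> \<beta> lam \<delta> I2 :: real and E :: "real set"
  assumes "trials M N p T"
    and "N \<ge> 3" and "0 < c" and "c < 1" and "x1 > 0" and "x2 > 0"
    \<comment> \<open>the known formula for the limit \<open>\<alpha>\<close>\<close>
    and known: "(exceedance M N p T x1 x2 \<longlongrightarrow>
                  (LBINT u1:{x1/2..}. (LBINT u2:{x2/2..}. p20 N c u1 u2))) (regime c)"
    and \<rho>: "\<rho> = sqrt (x2 / x1)" and \<beta>: "\<beta> = 1 - c\<^sup>2" and lam: "lam = x1 / (2 * \<beta>)"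
    and \<delta>: "\<delta> = (real N - 3) / 2"
    and I2: "I2 = (LBINT t1:{1..}. (LBINT t2:{1..}.
               exp (- lam * (t1\<^sup>2 - 2 * c * \<rho> * t1 * t2 + \<rho>\<^sup>2 * t2\<^sup>2)) * (t1 * t2) powr (\<delta> + 1/2)))"
    and E: "E = {\<epsilon>. 0 < \<epsilon> \<and> \<epsilon> < min (\<rho> / c - 1) (1 / c - \<rho>) \<and>
                \<epsilon> * (2 * min (\<rho> - c) (1 - c * \<rho>) + \<epsilon>)
                  < (1 - c\<^sup>2) / c\<^sup>2 - (\<rho>\<^sup>2 - 2 * c * \<rho> + 1)}"
    and "lam > 1"
    and "x1 * x2 > (1 - c\<^sup>2)\<^sup>2 / c\<^sup>2 *
           ((real N / 4 - 1)\<^sup>2 * of_bool (N > 4) + (real N / 4)\<^sup>2 * of_bool (N = 3))"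
    and "c < \<rho>" and "\<rho> < 1 / c"
  shows "E \<noteq> {} \<and>
    (\<forall>\<epsilon>\<in>E. \<exists>\<theta>1 \<theta>2 \<theta>3 \<theta>4 \<theta>5 \<theta>6 \<theta>7 I4 I6 :: real.
       alpha M N p T c x1 x2 =
         (x1 * x2) powr (real N / 4)
           / ((2 * c) powr (real N / 2 - 1) * Gamma ((real N - 1) / 2) * sqrt (pi * (1 - c\<^sup>2)))
         * I2 * (1 + \<theta>1) \<and>
       I2 = exp (- lam * (\<rho>\<^sup>2 - 2 * c * \<rho> + 1)) *
         ((1 + \<theta>2) * (1 - \<theta>3) * (1 - \<theta>4) * (1 + \<theta>5) * (1 - \<theta>6) * (1 - \<theta>7)
            / (4 * lam\<^sup>2 * \<rho> * (\<rho> - c) * (1 - c * \<rho>)) + I4) \<and>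
       0 \<le> I4 \<and>
       I4 \<le> exp (- lam * \<epsilon> * (2 * min (\<rho> - c) (1 - c * \<rho>) + \<epsilon>))
            * exp (\<rho>\<^sup>2 - 2 * c * \<rho> + 1 + \<epsilon> * (2 * min (\<rho> - c) (1 - c * \<rho>) + \<epsilon>)) * I6 \<and>
       0 \<le> I6 \<and>
       I6 \<le> 1 / \<rho> powr (real N / 2) *
            ((2 * c) powr (real N / 2 - 1) * sqrt pi *
               (Gamma ((real N - 1) / 2) / (2 * (1 - c\<^sup>2) powr ((real N - 1) / 2)))
             + 2 powr (real N / 2 - 2) *
               ((Gamma (real N / 4))\<^sup>2 / (2 * (1 - c\<^sup>2) powr (real N / 4)))) \<and>
       \<bar>\<theta>1\<bar> \<le> Psi ((real N - 3) / 2) (c * sqrt (x1 * x2) / (1 - c\<^sup>2)) \<and>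
       0 \<le> \<theta>2 \<and> \<theta>2 \<le> ((1 + \<epsilon>) * (1 + \<epsilon> / \<rho>)) powr (real N / 2 - 1) - 1 \<and>
       0 \<le> \<theta>3 \<and> \<theta>3 \<le> \<epsilon> / (\<rho> - c) \<and>
       0 \<le> \<theta>4 \<and> \<theta>4 \<le> exp (- lam * \<epsilon> * (2 * (\<rho> - c - c * \<epsilon>) + \<epsilon>)) \<and>
       0 \<le> \<theta>5 \<and> \<theta>5 \<le> c * \<epsilon> / (\<rho> - c - c * \<epsilon>) \<and>
       0 \<le> \<theta>6 \<and> \<theta>6 \<le> \<epsilon> / (1 - c * \<rho> + \<epsilon>) \<and>
       \<theta>7 = exp (- lam * \<epsilon> * (2 * (1 - c * \<rho>) + \<epsilon>)))"
proof -
  note N = assms(2) and c = assms(3,4) and x1 = assms(5) and x2 = assms(6)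
    and lam1 = assms(14) and large = assms(15) and c\<rho> = assms(16) and \<rho>c = assms(17)
  define m where "m = real N / 2 - 1"
  have m: "m \<ge> 0" and m1: "m + 1 = real N / 2" and \<delta>m: "\<delta> + 1/2 = m"
    using N by (auto simp: m_def \<delta> field_simps)
  have b: "1 - c\<^sup>2 > 0" using c by (simp add: abs_square_less_1)
  have \<rho>0: "\<rho> > 0" using x1 x2 by (simp add: \<rho>)
  have \<rho>2: "x1 * \<rho>\<^sup>2 = x2" using x1 x2 by (simp add: \<rho>)
  have x1\<rho>: "x1 * \<rho> = sqrt (x1 * x2)"
    using x1 \<rho>0 by (intro real_sqrt_unique[symmetric]) (auto simp: \<rho>2[symmetric] power2_eq_square)
  have c\<rho>1: "c * \<rho> < 1" using \<rho>c c by (simp add: field_simps)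
  have k: "lam = x1 / (2 * (1 - c\<^sup>2))" "lam \<ge> 1" using lam \<beta> lam1 by auto
  define J where "J = integral\<^sup>L plane (on_rect {1..} {\<rho>..} (weight lam c m))"
  have I2_J: "I2 = J / \<rho> powr (m + 1)"
    unfolding I2 J_def \<delta>m by (rule rescaled_weight_integral[OF c k(2) m \<rho>0])
  define z0 where "z0 = c * sqrt (x1 * x2) / (1 - c\<^sup>2)"
  have z0: "z0 \<ge> 0" using c b x1 x2 by (simp add: z0_def)
  have z0_sq: "z0\<^sup>2 = x1 * x2 * (c\<^sup>2 / (1 - c\<^sup>2)\<^sup>2)"
    using x1 x2 by (simp add: z0_def power_divide power_mult_distrib)
  have z0_gt: "s < z0" if "(1 - c\<^sup>2)\<^sup>2 / c\<^sup>2 * s\<^sup>2 < x1 * x2" for s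
  proof (rule power2_less_imp_less[OF _ z0])
    show "s\<^sup>2 < z0\<^sup>2" unfolding z0_sq using that c b by (simp add: field_simps)
  qed
  have "\<exists>\<theta>. (LBINT u1:{x1 / 2..}. (LBINT u2:{x1 * \<rho>\<^sup>2 / 2..}. p20 N c u1 u2))
      = (x1\<^sup>2) powr (real N / 4) / ((2 * c) powr (real N / 2 - 1) * Gamma ((real N - 1) / 2) * sqrt (pi * (1 - c\<^sup>2)))
        * integral\<^sup>L plane (on_rect {1..} {\<rho>..} (weight (x1 / (2 * (1 - c\<^sup>2))) c (real N / 2 - 1))) * (1 + \<theta>)
      \<and> \<bar>\<theta>\<bar> \<le> Psi ((real N - 3) / 2) (c * x1 * \<rho> / (1 - c\<^sup>2))"
  proof (rule tail_integral_relative_error[OF N c x1 \<rho>0])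
    have z: "c * x1 * \<rho> / (1 - c\<^sup>2) = z0" using x1\<rho> by (simp add: z0_def mult.assoc)
    show "real N / 4 - 1 < c * x1 * \<rho> / (1 - c\<^sup>2)" if "N > 4"
      unfolding z using large that by (intro z0_gt) auto
    show "3/4 < c * x1 * \<rho> / (1 - c\<^sup>2)" if "N = 3"
      unfolding z using large that by (intro z0_gt) auto
  qed (use k in auto)
  then obtain \<theta>1 where \<theta>1: "(LBINT u1:{x1 / 2..}. (LBINT u2:{x2 / 2..}. p20 N c u1 u2))
      = (x1\<^sup>2) powr (real N / 4) / ((2 * c) powr (real N / 2 - 1) * Gamma ((real N - 1) / 2) * sqrt (pi * (1 - c\<^sup>2)))
        * J * (1 + \<theta>1)"
      "\<bar>\<theta>1\<bar> \<le> Psi ((real N - 3) / 2) (c * sqrt (x1 * x2) / (1 - c\<^sup>2))"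
    unfolding \<rho>2 J_def m_def k(1)[symmetric] mult.assoc[of c x1 \<rho>] x1\<rho> by blast
  have "(x1 * x2) powr (real N / 4) = (x1\<^sup>2 * \<rho>\<^sup>2) powr (real N / 4)"
    by (simp add: \<rho>2[symmetric] power2_eq_square mult_ac)
  also have "\<dots> = (x1\<^sup>2) powr (real N / 4) * (\<rho> powr 2) powr (real N / 4)"
    using \<rho>0 by (simp add: powr_mult)
  also have "(\<rho> powr 2) powr (real N / 4) = \<rho> powr (m + 1)"
    unfolding powr_powr m1 by simp
  finally have P: "(x1 * x2) powr (real N / 4) = (x1\<^sup>2) powr (real N / 4) * \<rho> powr (m + 1)" .
  have alpha: "alpha M N p T c x1 x2 =
         (x1 * x2) powr (real N / 4)
           / ((2 * c) powr (real N / 2 - 1) * Gamma ((real N - 1) / 2) * sqrt (pi * (1 - c\<^sup>2)))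
         * I2 * (1 + \<theta>1)"
    unfolding alpha_def tendsto_Lim[OF regime_nontrivial[OF c] known] \<theta>1(1) P I2_J
    using \<rho>0 by simp
  have Q: "quadrant_bound c m = (2 * c) powr (real N / 2 - 1) * sqrt pi *
               (Gamma ((real N - 1) / 2) / (2 * (1 - c\<^sup>2) powr ((real N - 1) / 2)))
             + 2 powr (real N / 2 - 2) *
               ((Gamma (real N / 4))\<^sup>2 / (2 * (1 - c\<^sup>2) powr (real N / 4)))"
  proof -
    have "m + 1/2 = (real N - 1) / 2" "(m + 1) / 2 = real N / 4" "m - 1 = real N / 2 - 2"
      by (auto simp: m_def field_simps)
    then show ?thesis unfolding quadrant_bound_def by (simp only: m_def)
  qed
  show ?thesis
  proof (intro conjI ballI, goal_cases)
    case 1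
    \<comment> \<open>the admissible \<open>\<epsilon>\<close> are the small ones, once the gap on the right of the last condition is seen to be positive\<close>
    define h where "h = 1 - c\<^sup>2"
    define \<mu> where "\<mu> = min (\<rho> - c) (1 - c * \<rho>)"
    define gap where "gap = (1 - c\<^sup>2) / c\<^sup>2 - (\<rho>\<^sup>2 - 2 * c * \<rho> + 1)"
    have \<mu>: "\<mu> > 0" using c\<rho> c\<rho>1 by (simp add: \<mu>_def)
    have "\<rho> - c < h / c" using \<rho>c c by (simp add: h_def field_simps power2_eq_square)
    then have "(\<rho> - c)\<^sup>2 < (h / c)\<^sup>2" using c\<rho> by (intro power_strict_mono) auto
    moreover have "(h / c)\<^sup>2 + h = (1 - c\<^sup>2) / c\<^sup>2"
      using c by (simp add: h_def power2_eq_square field_simps)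
    moreover have "\<rho>\<^sup>2 - 2 * c * \<rho> + 1 = (\<rho> - c)\<^sup>2 + h"
      by (simp add: h_def power2_eq_square algebra_simps)
    ultimately have gap: "gap > 0" unfolding gap_def by linarith
    define w where "w = min (\<rho> / c - 1) (1 / c - \<rho>)"
    define \<epsilon> where "\<epsilon> = min (w / 2) (min 1 (gap / (2 * (2 * \<mu> + 1))))"
    have "w > 0" using c\<rho> \<rho>c c by (auto simp: w_def field_simps)
    then have \<epsilon>: "\<epsilon> > 0" "\<epsilon> < w" "\<epsilon> \<le> 1" "\<epsilon> \<le> gap / (2 * (2 * \<mu> + 1))"
      using gap \<mu> by (auto simp: \<epsilon>_def)
    have "\<epsilon> * (2 * \<mu> + \<epsilon>) \<le> gap / (2 * (2 * \<mu> + 1)) * (2 * \<mu> + 1)"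
      using \<epsilon> \<mu> gap by (intro mult_mono) auto
    also have "\<dots> < gap" using gap \<mu> by (simp add: divide_simps)
    finally have "\<epsilon> \<in> E" using \<epsilon> by (simp add: E \<mu>_def gap_def w_def)
    then show ?case by blast
  next
    case (2 \<epsilon>)
    then have \<epsilon>: "\<epsilon> > 0" "\<epsilon> < \<rho> / c - 1" "\<epsilon> < 1 / c - \<rho>" by (auto simp: E)
    have ce: "c * \<epsilon> < \<rho> - c" "c * \<epsilon> < 1 - c * \<rho>" using \<epsilon>(2,3) c by (auto simp: field_simps)
    obtain t2 t3 t4 t5 t6 R where t:
      "J / \<rho> powr (m + 1) = exp (- lam * (\<rho>\<^sup>2 - 2 * c * \<rho> + 1)) *
        ((1 + t2) * (1 - t3) * (1 - t4) * (1 + t5) * (1 - t6) * (1 - exp (- lam * \<epsilon> * (2 * (1 - c * \<rho>) + \<epsilon>)))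
          / (4 * lam\<^sup>2 * \<rho> * (\<rho> - c) * (1 - c * \<rho>)) + R)"
      "0 \<le> R" "R \<le> exp (- lam * (\<epsilon> * (2 * min (\<rho> - c) (1 - c * \<rho>) + \<epsilon>)))
        * exp (\<rho>\<^sup>2 - 2 * c * \<rho> + 1 + \<epsilon> * (2 * min (\<rho> - c) (1 - c * \<rho>) + \<epsilon>))
        * (1 / \<rho> powr (m + 1) * quadrant_bound c m)"
      "0 \<le> t2" "t2 \<le> ((1 + \<epsilon>) * (1 + \<epsilon> / \<rho>)) powr m - 1"
      "0 \<le> t3" "t3 \<le> \<epsilon> / (\<rho> - c)"
      "0 \<le> t4" "t4 \<le> exp (- lam * \<epsilon> * (2 * (\<rho> - c - c * \<epsilon>) + \<epsilon>))"
      "0 \<le> t5" "t5 \<le> c * \<epsilon> / (\<rho> - c - c * \<epsilon>)"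
      "0 \<le> t6" "t6 \<le> \<epsilon> / (1 - c * \<rho> + \<epsilon>)"
      using corner_integral_expansion[OF c k(2) m \<epsilon>(1) c\<rho> c\<rho>1 ce] unfolding J_def by blast
    \<comment> \<open>the bound on \<open>R\<close> already integrates over the whole positive quadrant, so \<open>I6\<close> is that bound and not the integral outside the box\<close>
    define I6 where "I6 = 1 / \<rho> powr (m + 1) * quadrant_bound c m"
    have I6: "0 \<le> I6" "I6 \<le> 1 / \<rho> powr (real N / 2) * quadrant_bound c m"
      using quadrant_bound_nonneg[OF m, of c] by (simp_all add: I6_def m1)
    have assoc: "- lam * (\<epsilon> * v) = - lam * \<epsilon> * v" for v by simp
    note results = alpha t(1)[folded I2_J] t(2) t(3)[folded I6_def, unfolded assoc]
      I6(1) I6(2)[unfolded Q] \<theta>1(2) t(4) t(5)[unfolded m_def] t(6-13)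
    show ?case
      by (rule exI[of _ \<theta>1], rule exI[of _ t2], rule exI[of _ t3], rule exI[of _ t4], rule exI[of _ t5],
          rule exI[of _ t6], rule exI[of _ "exp (- lam * \<epsilon> * (2 * (1 - c * \<rho>) + \<epsilon>))"],
          rule exI[of _ R], rule exI[of _ I6], intro conjI)
        (fact results refl)+
  qed
qed

end
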